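(* Let $k\ge2$ and let $F$ be a minimally unsatisfiable 2-CNF of deficiency $k$. Then the implication digraph $\mathrm{idg}(F)$ is a $2k$-weak-double-cycle.
   Context: Literals are variables and their complements; a clause is a finite set of literals without complementary pair; a 2-CNF is a finite set of clauses of size at most 2. Deficiency $\delta(F)=|F|-n(F)$, $n(F)$ the number of variables. Minimally unsatisfiable: unsatisfiable, and removing any clause makes it satisfiable. For a 2-CNF $F$ without empty clause, $\mathrm{idg}(F)$ has vertex set the literals over variables of $F$, arcs $(\overline x,x)$ for unit-clauses $\{x\}$, and arcs $(\overline x,y),(\overline y,x)$ for clauses $\{x,y\}$, $x\neq y$. Digraphs: no loops, no parallel arcs. For $m\ge3$ a double $m$-cycle is a digraph isomorphic to the one with vertices $1,\dots,m$ and arcs $(i,i+1),(i+1,i)$ (indices mod $m$). Splitting a vertex $x$ replaces $x$ by new vertices $u,w$ with an arc $(u,w)$, arcs into $x$ now into $u$, arcs out of $x$ now out of $w$. Splitting an arc $(x,y)$ replaces it by $(x,w),(w,y)$ for a new vertex $w$. An $m$-weak-double-cycle ($m$-WDC) is a digraph obtained from a double $m$-cycle by finitely many vertex- and arc-splittings. *)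

theory Defs
  imports
    "Graph_Theory.Pair_Digraph"
    "Graph_Theory.Digraph_Isomorphism"
begin

datatype 'v lit = Pos (var: 'v) | Neg (var: 'v)

fun compl :: "'v lit \<Rightarrow> 'v lit" where
  "compl (Pos v) = Neg v"
| "compl (Neg v) = Pos v"

type_synonym 'v clause = "'v lit set"

definition is_clause :: "'v clause \<Rightarrow> bool" where
  "is_clause C \<longleftrightarrow> finite C \<and> (\<forall>x\<in>C. compl x \<notin> C)"

definition is_2cnf :: "'v clause set \<Rightarrow> bool" where
  "is_2cnf F \<longleftrightarrow> finite F \<and> (\<forall>C\<in>F. is_clause C \<and> card C \<le> 2)"

definition vars :: "'v clause set \<Rightarrow> 'v set" where
  "vars F = var ` \<Union>F"

definition deficiency :: "'v clause set \<Rightarrow> int" where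
  "deficiency F = int (card F) - int (card (vars F))"

fun lit_true :: "('v \<Rightarrow> bool) \<Rightarrow> 'v lit \<Rightarrow> bool" where
  "lit_true \<phi> (Pos v) \<longleftrightarrow> \<phi> v"
| "lit_true \<phi> (Neg v) \<longleftrightarrow> \<not> \<phi> v"

definition satisfiable :: "'v clause set \<Rightarrow> bool" where
  "satisfiable F \<longleftrightarrow> (\<exists>\<phi>. \<forall>C\<in>F. \<exists>x\<in>C. lit_true \<phi> x)"

definition minimally_unsatisfiable :: "'v clause set \<Rightarrow> bool" where
  "minimally_unsatisfiable F \<longleftrightarrow> \<not> satisfiable F \<and> (\<forall>C\<in>F. satisfiable (F - {C}))"

text \<open>An empty clause contributes nothing to the digraph below; the notion is only meant for
  clause-sets without the empty clause.\<close>

definition idg :: "'v clause set \<Rightarrow> 'v lit pair_pre_digraph" where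
  "idg F = \<lparr>
     pverts = {x. var x \<in> vars F},
     parcs = {(compl x, x) | x. {x} \<in> F} \<union>
             {(compl x, y) | x y. {x, y} \<in> F \<and> x \<noteq> y} \<rparr>"

text \<open>Since \<open>{x, y} = {y, x}\<close>, the second set of arcs contains both arcs belonging to a binary
  clause.

  In the next definition \<open>i mod m + 1\<close> is the cyclic successor of \<open>i\<close> in \<open>{1..m}\<close>.\<close>

definition standard_double_cycle :: "nat \<Rightarrow> nat pair_pre_digraph" where
  "standard_double_cycle m = \<lparr>
     pverts = {1..m},
     parcs = (\<Union>i\<in>{1..m}. {(i, i mod m + 1), (i mod m + 1, i)}) \<rparr>"

definition double_cycle :: "nat \<Rightarrow> 'a pair_pre_digraph \<Rightarrow> bool" where
  "double_cycle m G \<longleftrightarrow>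
     3 \<le> m \<and> digraph_iso (with_proj G) (with_proj (standard_double_cycle m))"

definition split_vertex ::
    "'a pair_pre_digraph \<Rightarrow> 'a \<Rightarrow> 'a \<Rightarrow> 'a \<Rightarrow> 'a pair_pre_digraph" where
  "split_vertex G x u w = \<lparr>
     pverts = (pverts G - {x}) \<union> {u, w},
     parcs = {(a, b). (a, b) \<in> parcs G \<and> a \<noteq> x \<and> b \<noteq> x} \<union>
             {(a, u) | a. (a, x) \<in> parcs G} \<union>
             {(w, b) | b. (x, b) \<in> parcs G} \<union>
             {(u, w)} \<rparr>"

definition split_arc ::
    "'a pair_pre_digraph \<Rightarrow> 'a \<Rightarrow> 'a \<Rightarrow> 'a \<Rightarrow> 'a pair_pre_digraph" where
  "split_arc G x y w = \<lparr>
     pverts = pverts G \<union> {w},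
     parcs = (parcs G - {(x, y)}) \<union> {(x, w), (w, y)} \<rparr>"

text \<open>The splittings are carried out on natural numbers as vertices, so that new vertices are
  always available, and the result is then transferred by isomorphism to an arbitrary (possibly
  finite) vertex type.\<close>

inductive wdc_nat :: "nat \<Rightarrow> nat pair_pre_digraph \<Rightarrow> bool" for m where
  base: "double_cycle m G \<Longrightarrow> wdc_nat m G"
| vertex: "\<lbrakk>wdc_nat m G; x \<in> pverts G; u \<notin> pverts G; w \<notin> pverts G; u \<noteq> w\<rbrakk>
    \<Longrightarrow> wdc_nat m (split_vertex G x u w)"
| arc: "\<lbrakk>wdc_nat m G; (x, y) \<in> parcs G; w \<notin> pverts G\<rbrakk>
    \<Longrightarrow> wdc_nat m (split_arc G x y w)"

definition weak_double_cycle :: "nat \<Rightarrow> 'a pair_pre_digraph \<Rightarrow> bool" where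
  "weak_double_cycle m G \<longleftrightarrow>
     (\<exists>H. wdc_nat m H \<and> digraph_iso (with_proj G) (with_proj H))"

end

theory Submission
  imports Defs
begin

text \<open>
  If a literal \<open>a\<close> implies its complement, this is witnessed by a lasso: a walk from \<open>a\<close> through
  distinct variables which returns to the complement of a literal already visited. A minimally
  unsatisfiable 2-CNF is the union of the clauses of any lasso at \<open>a\<close> and any lasso at \<open>compl a\<close>,
  for every literal \<open>a\<close>. Hence there are no unit clauses for deficiency at least 2, and every
  literal occurs at most twice.

  If every literal occurs exactly twice, counting shows that every lasso runs through all
  variables. A chord cuts off a shorter lasso, so all arcs come in antiparallel pairs and the digraph
  is a double cycle of length \<open>2 * k\<close>. Otherwise some literal \<open>x\<close> occurs in a single clause
  \<open>{x, y}\<close>. Resolving on \<open>x\<close> removes one clause and one variable, and the inverse step is a pair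
  of arc splittings (if \<open>compl x\<close> also occurs once) or a pair of vertex splittings at \<open>y\<close> and
  \<open>compl y\<close> (if it occurs twice).
\<close>

section \<open>Literals and implications\<close>

lemma compl_compl [simp]: "compl (compl x) = x"
  by (cases x) auto

lemma var_compl [simp]: "var (compl x) = var x"
  by (cases x) auto

lemma compl_neq [simp]: "compl x \<noteq> x" "x \<noteq> compl x"
  by (cases x; simp)+

lemma compl_eq_iff [simp]: "compl x = compl y \<longleftrightarrow> x = y"
  by (metis compl_compl)

lemma var_eq_iff: "var x = var y \<longleftrightarrow> x = y \<or> x = compl y"
  by (cases x; cases y) auto

lemma lit_true_compl [simp]: "lit_true \<phi> (compl x) \<longleftrightarrow> \<not> lit_true \<phi> x"
  by (cases x) auto

lemma override_literal:
  obtains \<psi> where "lit_true \<psi> x \<longleftrightarrow> b" "\<And>y. var y \<noteq> var x \<Longrightarrow> lit_true \<psi> y \<longleftrightarrow> lit_true \<phi> y"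
proof
  \<comment> \<open>\<open>lit_true (\<lambda>_. True) x\<close> says that \<open>x\<close> is
    positive, so the variable gets the value \<open>b\<close> for \<open>Pos\<close> and the negated
    value for \<open>Neg\<close>.\<close>
  let ?\<psi> = "\<phi>(var x := (lit_true (\<lambda>_. True) x \<longleftrightarrow> b))"
  show "lit_true ?\<psi> x \<longleftrightarrow> b" by (cases x) auto
  show "lit_true ?\<psi> y \<longleftrightarrow> lit_true \<phi> y" if "var y \<noteq> var x" for y
    using that by (cases y) auto
qed

text \<open>A unit clause \<open>{b}\<close> is \<open>{b, b}\<close>, so one formula treats unit
  and binary clauses alike; \<open>parcs_idg\<close> identifies this relation with the arcs of the
  implication digraph.\<close>

definition imp :: "'v clause set \<Rightarrow> 'v lit rel" where
  "imp F = {(a, b). {compl a, b} \<in> F}"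

lemma imp_contrapos: "(a, b) \<in> imp F \<Longrightarrow> (compl b, compl a) \<in> imp F"
  by (auto simp: imp_def insert_commute)

lemma imp_rtrancl_contrapos: "(a, b) \<in> (imp F)\<^sup>* \<Longrightarrow> (compl b, compl a) \<in> (imp F)\<^sup>*"
  by (induction rule: rtrancl_induct) (auto intro: imp_contrapos converse_rtrancl_into_rtrancl)

lemma imp_mono: "E \<subseteq> F \<Longrightarrow> imp E \<subseteq> imp F"
  by (auto simp: imp_def)

lemma parcs_idg: "parcs (idg F) = imp F"
proof -
  have "(a, b) \<in> parcs (idg F)" if "{compl a, b} \<in> F" for a b
  proof (cases "b = compl a")
    case True
    with that have "(a, b) = (compl b, b)" "{b} \<in> F" by auto
    then show ?thesis unfolding idg_def by simp
  next
    case False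
    then have "(a, b) = (compl (compl a), b)" "{compl a, b} \<in> F \<and> compl a \<noteq> b" using that by auto
    then show ?thesis unfolding idg_def by (simp only: pair_pre_digraph.simps) blast
  qed
  then have "imp F \<subseteq> parcs (idg F)" by (auto simp: imp_def)
  moreover have "parcs (idg F) \<subseteq> imp F" by (auto simp: idg_def imp_def)
  ultimately show ?thesis by blast
qed

lemma pverts_idg: "pverts (idg F) = {x. var x \<in> vars F}"
  by (simp add: idg_def)

lemma imp_in_vars: "(a, b) \<in> imp F \<Longrightarrow> var a \<in> vars F \<and> var b \<in> vars F"
proof -
  assume "(a, b) \<in> imp F"
  then have "compl a \<in> \<Union>F" "b \<in> \<Union>F" unfolding imp_def by blast+
  then have "var (compl a) \<in> vars F" "var b \<in> vars F" unfolding vars_def by blast+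
  then show ?thesis by simp
qed

lemma finite_vars: "is_2cnf F \<Longrightarrow> finite (vars F)"
  by (auto simp: is_2cnf_def is_clause_def vars_def)

lemma card_literals:
  assumes "finite V" shows "finite {x. var x \<in> V}" "card {x. var x \<in> V} = 2 * card V"
proof -
  have eq: "{x. var x \<in> V} = Pos ` V \<union> Neg ` V"
  proof safe
    fix x assume "var x \<in> V" "x \<notin> Neg ` V"
    then show "x \<in> Pos ` V" by (cases x) auto
  qed auto
  show "finite {x. var x \<in> V}" using assms eq by simp
  show "card {x. var x \<in> V} = 2 * card V" unfolding eq using assms
    by (subst card_Un_disjoint) (auto simp: card_image inj_on_def)
qed

lemma card_doubleton_le: "card {a, b} \<le> 2"
  by (simp add: card_insert_if)

lemma clause_as_imp:
  assumes "is_2cnf F" "{} \<notin> F" "C \<in> F"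
  obtains a b where "C = {compl a, b}" "(a, b) \<in> imp F"
proof -
  have "finite C" "card C \<le> 2" "C \<noteq> {}"
    using assms by (auto simp: is_2cnf_def is_clause_def)
  then have "card C = 1 \<or> card C = 2"
    using card_gt_0_iff[of C] by linarith
  then obtain x y where "C = {x, y}"
    by (auto simp: card_1_singleton_iff card_2_iff)
  then have "C = {compl (compl x), y}" by simp
  with \<open>C \<in> F\<close> show thesis by (intro that[of "compl x" y]) (auto simp: imp_def)
qed

lemma imp_not_refl: "is_2cnf F \<Longrightarrow> (a, b) \<in> imp F \<Longrightarrow> a \<noteq> b"
  by (auto simp: is_2cnf_def is_clause_def imp_def)

section \<open>Unsatisfiability of 2-CNFs\<close>

lemma imp_rtrancl_true:
  assumes "\<forall>C\<in>F. \<exists>x\<in>C. lit_true \<phi> x" "(a, b) \<in> (imp F)\<^sup>*" "lit_true \<phi> a"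
  shows "lit_true \<phi> b"
  using assms(2)
proof (induction rule: rtrancl_induct)
  case (step b c)
  then have "{compl b, c} \<in> F" by (simp add: imp_def)
  with assms(1) have "\<exists>x\<in>{compl b, c}. lit_true \<phi> x" by blast
  with step show ?case by simp
qed (rule assms(3))

lemma unsat_if_contradictory:
  assumes "(a, compl a) \<in> (imp F)\<^sup>*" "(compl a, a) \<in> (imp F)\<^sup>*"
  shows "\<not> satisfiable F"
proof
  assume "satisfiable F"
  then obtain \<phi> where "\<forall>C\<in>F. \<exists>x\<in>C. lit_true \<phi> x"
    unfolding satisfiable_def by blast
  from imp_rtrancl_true[OF this assms(1)] imp_rtrancl_true[OF this assms(2)]
  show False unfolding lit_true_compl by blast
qed

text \<open>A maximal consistent set of literals closed under implication is a satisfying assignment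
  unless some variable cannot be added to it with either sign.\<close>

lemma unsat_imp_contradictory:
  assumes F: "is_2cnf F" "{} \<notin> F" and unsat: "\<not> satisfiable F"
  obtains a where "(a, compl a) \<in> (imp F)\<^sup>*" "(compl a, a) \<in> (imp F)\<^sup>*"
proof (rule ccontr)
  assume "\<not> thesis"
  then have no: "(a, compl a) \<notin> (imp F)\<^sup>* \<or> (compl a, a) \<notin> (imp F)\<^sup>*" for a
    using that by blast
  define L where "L = {x. var x \<in> vars F}"
  define good where "good S \<longleftrightarrow> S \<subseteq> L \<and> imp F `` S \<subseteq> S \<and> (\<forall>x\<in>S. compl x \<notin> S)" for S
  have finL: "finite L"
    unfolding L_def by (intro card_literals finite_vars F)
  have "\<exists>S. good S \<and> (\<forall>T. good T \<longrightarrow> card T \<le> card S)"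
  proof (rule ex_has_greatest_nat)
    show "good {}" by (simp add: good_def)
    show "\<forall>T. good T \<longrightarrow> card T < Suc (card L)"
      using finL by (auto simp: good_def less_Suc_eq_le intro: card_mono)
  qed
  then obtain S where S: "good S" and max: "\<And>T. good T \<Longrightarrow> card T \<le> card S"
    by blast
  have S_closed: "b \<in> S" if "a \<in> S" "(a, b) \<in> (imp F)\<^sup>*" for a b
    using that(2)
  proof induction
    case base then show ?case using that by simp
  next
    case (step y z) then show ?case using S by (auto simp: good_def)
  qed
  have total: "x \<in> S \<or> compl x \<in> S" if "x \<in> L" for x
  proof (rule ccontr)
    assume notin: "\<not> (x \<in> S \<or> compl x \<in> S)"
    \<comment> \<open>By \<open>no\<close>, at most one of \<open>x\<close> and
      \<open>compl x\<close> reaches its complement; \<open>z\<close> is one that does not.\<close>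
    define z where "z = (if (x, compl x) \<in> (imp F)\<^sup>* then compl x else x)"
    have z: "(z, compl z) \<notin> (imp F)\<^sup>*" "z \<in> L" "z \<notin> S" "compl z \<notin> S"
      using no[of x] notin \<open>x \<in> L\<close> by (auto simp: z_def L_def)
    define R where "R = (imp F)\<^sup>* `` {z}"
    have "R \<subseteq> L"
    proof
      fix y assume "y \<in> R"
      then have "(z, y) \<in> (imp F)\<^sup>*" by (simp add: R_def)
      then show "y \<in> L"
      proof (cases rule: rtranclE)
        case base then show ?thesis using z(2) by simp
      next
        case (step b) then show ?thesis using imp_in_vars[of b y F] by (simp add: L_def)
      qed
    qed
    moreover have "imp F `` R \<subseteq> R"
      by (auto simp: R_def intro: rtrancl_into_rtrancl)
    \<comment> \<open>If \<open>z\<close> reached both \<open>y\<close> and \<open>compl y\<close>,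
      contraposition would lead from \<open>y\<close> on to \<open>compl z\<close>.\<close>
    moreover have "compl y \<notin> R" if "y \<in> R" for y
    proof
      assume "compl y \<in> R"
      then have "(y, compl z) \<in> (imp F)\<^sup>*"
        using imp_rtrancl_contrapos[of z "compl y" F] by (simp add: R_def)
      with that z(1) show False unfolding R_def by (metis Image_singleton_iff rtrancl_trans)
    qed
    \<comment> \<open>By contraposition \<open>compl y\<close> reaches \<open>compl z\<close>. As
      \<open>S\<close> is closed, \<open>compl y \<in> S\<close> would put \<open>compl z\<close>
      into \<open>S\<close>.\<close>
    moreover have "compl y \<notin> S" if "y \<in> R" for y
      using that z(4) S_closed[of "compl y" "compl z"] imp_rtrancl_contrapos[of z y F]
      by (auto simp: R_def)
    moreover from this have "compl y \<notin> R" if "y \<in> S" for y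
      using that by (metis compl_compl)
    ultimately have "good (S \<union> R)"
      using S unfolding good_def Image_Un Ball_def Un_iff by (meson Un_least Un_mono)
    moreover have "S \<subset> S \<union> R" using z(3) by (auto simp: R_def)
    moreover have "finite (S \<union> R)"
      using \<open>good (S \<union> R)\<close> finL unfolding good_def by (meson finite_subset)
    ultimately show False
      using max[of "S \<union> R"] psubset_card_mono[of "S \<union> R" S] by simp
  qed
  define \<phi> where "\<phi> v \<longleftrightarrow> Pos v \<in> S" for v
  have true: "lit_true \<phi> x" if "x \<in> S" for x
    using that S by (cases x) (auto simp: \<phi>_def good_def)
  have "\<exists>x\<in>C. lit_true \<phi> x" if "C \<in> F" for C
  proof -
    obtain a b where ab: "C = {compl a, b}" "(a, b) \<in> imp F"
      using clause_as_imp[OF F \<open>C \<in> F\<close>] .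
    then have "a \<in> L" by (auto simp: L_def dest: imp_in_vars)
    with total[of a] S_closed[of a b] ab(2) have "compl a \<in> S \<or> b \<in> S" by auto
    then show ?thesis using true[of "compl a"] true[of b] ab(1) by auto
  qed
  then show False using unsat unfolding satisfiable_def by blast
qed

section \<open>Lassos\<close>

text \<open>Variables are distinct only below \<open>j\<close>, because \<open>l j\<close> repeats
  the variable of \<open>l i\<close>. The case \<open>i = j - 1\<close> is a walk ending with a unit
  clause.\<close>

definition lasso :: "'v clause set \<Rightarrow> (nat \<Rightarrow> 'v lit) \<Rightarrow> nat \<Rightarrow> nat \<Rightarrow> bool" where
  "lasso F l i j \<longleftrightarrow> i < j \<and> l j = compl (l i) \<and> inj_on (\<lambda>t. var (l t)) {..<j} \<and>
     (\<forall>t<j. (l t, l (Suc t)) \<in> imp F)"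

definition walk_clauses :: "(nat \<Rightarrow> 'v lit) \<Rightarrow> nat \<Rightarrow> 'v clause set" where
  "walk_clauses l j = (\<lambda>t. {compl (l t), l (Suc t)}) ` {..<j}"

lemma walk_relpow:
  assumes "\<And>t. t < j \<Longrightarrow> (l t, l (Suc t)) \<in> R" "s \<le> t" "t \<le> j"
  shows "(l s, l t) \<in> R ^^ (t - s)"
  unfolding relpow_fun_conv
  by (rule exI[of _ "\<lambda>u. l (s + u)"]) (use assms in auto)

lemma lasso_rtrancl:
  assumes "lasso F l i j" "s \<le> t" "t \<le> j"
  shows "(l s, l t) \<in> (imp F)\<^sup>*"
  using walk_relpow[of j l "imp F" s t] assms
  by (auto simp: lasso_def intro: relpow_imp_rtrancl)

text \<open>The tail of the walk leads from \<open>l t\<close> to \<open>l j\<close>, and its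
  contrapositive leads from \<open>compl (l j) = l i\<close> to \<open>compl (l t)\<close>. With
  \<open>t = 0\<close> the start reaches its own complement.\<close>

lemma lasso_reaches:
  assumes "lasso F l i j" "t \<le> j"
  shows "(l 0, l t) \<in> (imp F)\<^sup>*" "(l 0, compl (l t)) \<in> (imp F)\<^sup>*"
proof -
  show "(l 0, l t) \<in> (imp F)\<^sup>*" using assms by (intro lasso_rtrancl) auto
  have "l i = compl (l j)" "i \<le> j" using assms by (auto simp: lasso_def)
  then have "(l i, compl (l t)) \<in> (imp F)\<^sup>*"
    using imp_rtrancl_contrapos[OF lasso_rtrancl[OF assms(1) assms(2) order_refl]] by simp
  with lasso_rtrancl[OF assms(1), of 0 i] \<open>i \<le> j\<close>
  show "(l 0, compl (l t)) \<in> (imp F)\<^sup>*" by (auto intro: rtrancl_trans)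
qed

lemma lasso_walk_clauses:
  assumes "lasso F l i j" shows "lasso (walk_clauses l j) l i j" "walk_clauses l j \<subseteq> F"
  using assms by (auto simp: lasso_def walk_clauses_def imp_def)

lemma card_walk_clauses: "card (walk_clauses l j) \<le> j"
  unfolding walk_clauses_def using card_image_le[of "{..<j}"] by simp

text \<open>Take a shortest walk from \<open>x\<close> to \<open>compl x\<close> and stop at the
  first repeated variable. No literal repeats on a shortest walk, so the repetition is a
  complement.\<close>

lemma ex_lasso:
  assumes "(x, compl x) \<in> (imp F)\<^sup>*"
  obtains l i j where "lasso F l i j" "l 0 = x"
proof -
  define n where "n = (LEAST n. (x, compl x) \<in> imp F ^^ n)"
  have "\<exists>n. (x, compl x) \<in> imp F ^^ n"
    using assms by (rule rtrancl_imp_relpow)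
  then have "(x, compl x) \<in> imp F ^^ n" unfolding n_def by (rule LeastI_ex)
  then obtain l where l: "l 0 = x" "l n = compl x" "\<And>t. t < n \<Longrightarrow> (l t, l (Suc t)) \<in> imp F"
    unfolding relpow_fun_conv by blast
  have inj: "l s \<noteq> l t" if "s < t" "t \<le> n" for s t
  proof
    assume "l s = l t"
    have "(l 0, l s) \<in> imp F ^^ (s - 0)" "(l t, l n) \<in> imp F ^^ (n - t)"
      using that by (intro walk_relpow[of n]; simp add: l)+
    with \<open>l s = l t\<close> have "(x, compl x) \<in> imp F ^^ (s + (n - t))"
      by (auto simp: relpow_add l)
    then have "n \<le> s + (n - t)" unfolding n_def by (rule Least_le)
    with that show False by simp
  qed
  define P where "P j \<longleftrightarrow> j \<le> n \<and> (\<exists>i<j. var (l i) = var (l j))" for j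
  define j where "j = (LEAST j. P j)"
  \<comment> \<open>The end \<open>compl x\<close> repeats the variable of index 0, so some
    repetition exists.\<close>
  have "n \<noteq> 0" using l(1,2) by (metis compl_neq(1))
  then have "P n" unfolding P_def using l(1,2) by (auto intro!: exI[of _ 0])
  then have "P j" unfolding j_def by (rule LeastI)
  then obtain i where i: "i < j" "j \<le> n" "var (l i) = var (l j)" unfolding P_def by blast
  have "l j = compl (l i)" using i inj[of i j] by (auto simp: var_eq_iff)
  moreover have "inj_on (\<lambda>t. var (l t)) {..<j}"
  proof (rule linorder_inj_onI)
    fix s t assume "s < t" "s \<in> {..<j}" "t \<in> {..<j}"
    then have "\<not> P t" unfolding j_def by (auto dest: not_less_Least)
    with \<open>s < t\<close> \<open>t \<in> {..<j}\<close> i(2) show "var (l s) \<noteq> var (l t)"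
      unfolding P_def by auto
  qed auto
  ultimately have "lasso F l i j" using i l(3) by (simp add: lasso_def)
  then show thesis using that l(1) by blast
qed

section \<open>Minimally unsatisfiable 2-CNFs as unions of two lassos\<close>

locale mu_2cnf =
  fixes F :: "'v clause set"
  assumes cnf: "is_2cnf F" and nonempty: "{} \<notin> F" and mu: "minimally_unsatisfiable F"
begin

lemma unsat_subset_eq:
  assumes "E \<subseteq> F" "\<not> satisfiable E"
  shows "E = F"
proof (rule ccontr)
  assume "E \<noteq> F"
  with assms obtain C where C: "C \<in> F" "E \<subseteq> F - {C}" by blast
  with mu have "satisfiable (F - {C})" by (simp add: minimally_unsatisfiable_def)
  with C(2) have "satisfiable E" unfolding satisfiable_def by (meson subsetD)
  with assms(2) show False ..
qed

text \<open>Each lasso takes its start to the complement of that start, so the clauses of the two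
  are already unsatisfiable and minimality leaves no others.\<close>

lemma lassos_cover:
  assumes "lasso F l i j" "lasso F q i' j'" "q 0 = compl (l 0)"
  shows "walk_clauses l j \<union> walk_clauses q j' = F"
proof (rule unsat_subset_eq)
  let ?E = "walk_clauses l j \<union> walk_clauses q j'"
  show "?E \<subseteq> F" using lasso_walk_clauses(2)[OF assms(1)] lasso_walk_clauses(2)[OF assms(2)] by simp
  have "(l 0, compl (l 0)) \<in> (imp ?E)\<^sup>*"
    using lasso_reaches(2)[OF lasso_walk_clauses(1)[OF assms(1)], of 0]
      rtrancl_mono[OF imp_mono[of "walk_clauses l j" ?E]] by blast
  moreover have "(q 0, compl (q 0)) \<in> (imp ?E)\<^sup>*"
    using lasso_reaches(2)[OF lasso_walk_clauses(1)[OF assms(2)], of 0]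
      rtrancl_mono[OF imp_mono[of "walk_clauses q j'" ?E]] by blast
  ultimately show "\<not> satisfiable ?E"
    using unsat_if_contradictory[of "l 0" ?E] assms(3) by simp
qed

lemma var_in_vars_clause:
  assumes "var y \<in> vars F"
  obtains C where "C \<in> F" "y \<in> C \<or> compl y \<in> C"
proof -
  from assms obtain C z where "C \<in> F" "z \<in> C" "var y = var z" by (auto simp: vars_def)
  moreover from this have "y = z \<or> compl y = z" by (auto simp: var_eq_iff)
  ultimately show thesis using that by blast
qed

text \<open>Lassos at a contradictory literal \<open>a\<close> and at its complement contain all
  clauses, and each lasso reaches both literals of each of its variables. So \<open>a\<close>
  reaches every literal, by contraposition every literal reaches \<open>compl a\<close>, and
  \<open>compl a\<close> reaches \<open>a\<close>.\<close>

lemma strongly_connected: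
  assumes "var x \<in> vars F" "var y \<in> vars F"
  shows "(x, y) \<in> (imp F)\<^sup>*"
proof -
  have "\<not> satisfiable F" using mu by (simp add: minimally_unsatisfiable_def)
  then obtain a where a: "(a, compl a) \<in> (imp F)\<^sup>*" "(compl a, a) \<in> (imp F)\<^sup>*"
    using unsat_imp_contradictory[OF cnf nonempty] by blast
  obtain l i j where l: "lasso F l i j" "l 0 = a" using ex_lasso[OF a(1)] .
  obtain q i' j' where q: "lasso F q i' j'" "q 0 = compl a"
    using ex_lasso[of "compl a" F] a(2) by auto
  have reach: "(a, z) \<in> (imp F)\<^sup>*" if z: "var z \<in> vars F" for z
  proof -
    obtain C where C: "C \<in> F" "z \<in> C \<or> compl z \<in> C" using var_in_vars_clause[OF z] .
    from C(1) lassos_cover[OF l(1) q(1)] l(2) q(2)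
    have "C \<in> walk_clauses l j \<or> C \<in> walk_clauses q j'" by auto
    then show ?thesis
    proof
      assume "C \<in> walk_clauses l j"
      then obtain t where t: "t < j" "C = {compl (l t), l (Suc t)}"
        by (auto simp: walk_clauses_def)
      then have "z \<in> {l t, compl (l t), l (Suc t), compl (l (Suc t))}"
        using C(2) by (metis compl_compl insert_iff singletonD)
      then show ?thesis
        using lasso_reaches[OF l(1), of t] lasso_reaches[OF l(1), of "Suc t"] t(1) l(2) by auto
    next
      assume "C \<in> walk_clauses q j'"
      then obtain t where t: "t < j'" "C = {compl (q t), q (Suc t)}"
        by (auto simp: walk_clauses_def)
      then have "z \<in> {q t, compl (q t), q (Suc t), compl (q (Suc t))}"
        using C(2) by (metis compl_compl insert_iff singletonD)
      then have "(compl a, z) \<in> (imp F)\<^sup>*"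
        using lasso_reaches[OF q(1), of t] lasso_reaches[OF q(1), of "Suc t"] t(1) q(2) by auto
      with a(1) show ?thesis by (rule rtrancl_trans)
    qed
  qed
  have "(x, compl a) \<in> (imp F)\<^sup>*"
    using imp_rtrancl_contrapos[OF reach[of "compl x"]] assms(1) by simp
  with a(2) reach[OF assms(2)] show ?thesis by (metis rtrancl_trans)
qed

lemma ex_lasso_at:
  assumes "var x \<in> vars F"
  obtains l i j where "lasso F l i j" "l 0 = x"
  using ex_lasso[of x F] strongly_connected[of x "compl x"] assms by auto

lemma lasso_var: "lasso F l i j \<Longrightarrow> t < j \<Longrightarrow> var (l t) \<in> vars F"
  unfolding lasso_def using imp_in_vars by blast

lemma lasso_length:
  assumes "lasso F l i j" shows "j \<le> card (vars F)"
proof -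
  have "card ((\<lambda>t. var (l t)) ` {..<j}) \<le> card (vars F)"
    using assms by (intro card_mono finite_vars cnf) (auto dest: lasso_var)
  then show ?thesis using assms by (simp add: lasso_def card_image)
qed

lemma lasso_start: "lasso F l i j \<Longrightarrow> t < j \<Longrightarrow> var (l t) = var (l 0) \<Longrightarrow> t = 0"
  unfolding lasso_def inj_on_def by auto

lemma card_le_lassos:
  assumes "lasso F l i j" "lasso F q i' j'" "q 0 = compl (l 0)"
  shows "card F \<le> j + j'"
proof -
  have "card F \<le> card (walk_clauses l j) + card (walk_clauses q j')"
    using card_Un_le[of "walk_clauses l j" "walk_clauses q j'"] lassos_cover[OF assms] by simp
  with card_walk_clauses[of l j] card_walk_clauses[of q j'] show ?thesis by linarith
qed

text \<open>The unit clause alone is a lasso of length 1 at \<open>compl u\<close>, and a lasso at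
  \<open>u\<close> supplies at most \<open>card (vars F)\<close> further clauses.\<close>

lemma unit_clause_deficiency:
  assumes "{u} \<in> F" shows "card F \<le> card (vars F) + 1"
proof -
  have u: "(compl u, u) \<in> imp F" using assms by (simp add: imp_def)
  then have lasso: "lasso F (\<lambda>t. if t = 0 then compl u else u) 0 1"
    by (auto simp: lasso_def inj_on_def)
  obtain q i' j' where q: "lasso F q i' j'" "q 0 = u"
    using ex_lasso_at[of u] imp_in_vars[OF u] by auto
  show ?thesis using card_le_lassos[OF lasso q(1)] q lasso_length[OF q(1)] by simp
qed

text \<open>The clause of this arc lies on \<open>l\<close> or on a lasso at
  \<open>compl (l 0)\<close>. A lasso meets the variable of its start again at most at its end, and
  only if it closes there. So \<open>l\<close> offers its first clause and possibly its
  last.\<close>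

lemma out_neighbours_lasso:
  assumes l: "lasso F l i j" and b: "(l 0, b) \<in> imp F"
  shows "b = l 1 \<or> i = 0 \<and> b = compl (l (j - 1))"
proof -
  have "var (l 0) \<in> vars F" using imp_in_vars[OF b] by simp
  then obtain q i' j' where q: "lasso F q i' j'" "q 0 = compl (l 0)"
    using ex_lasso_at[of "compl (l 0)"] by auto
  have "{compl (l 0), b} \<in> walk_clauses l j \<union> walk_clauses q j'"
    using b lassos_cover[OF l q] by (simp add: imp_def)
  then show ?thesis
  proof
    assume "{compl (l 0), b} \<in> walk_clauses l j"
    then obtain t where t: "t < j" "{compl (l 0), b} = {compl (l t), l (Suc t)}"
      by (auto simp: walk_clauses_def)
    from t(2) consider "l t = l 0" "b = l (Suc t)" | "l (Suc t) = compl (l 0)" "b = compl (l t)"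
      by (auto simp: doubleton_eq_iff)
    then show ?thesis
    proof cases
      case 1
      then have "t = 0" using lasso_start[OF l t(1)] by simp
      with 1 show ?thesis by simp
    next
      case 2
      then have "\<not> Suc t < j" using lasso_start[OF l, of "Suc t"] by auto
      with t(1) have j: "j = Suc t" by simp
      then have "l i = l 0" using 2 l by (auto simp: lasso_def)
      then have "i = 0" using lasso_start[OF l, of i] l by (simp add: lasso_def)
      with 2 j show ?thesis by simp
    qed
  next
    \<comment> \<open>No clause of this lasso contains \<open>q 0\<close>: the first one contains
      \<open>compl (q 0)\<close>, and an end with the variable of \<open>q 0\<close> is
      \<open>compl (q 0)\<close> again.\<close>
    assume "{compl (l 0), b} \<in> walk_clauses q j'"
    then obtain t where t: "t < j'" "{q 0, b} = {compl (q t), q (Suc t)}"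
      using q(2) by (auto simp: walk_clauses_def)
    from t(2) consider "compl (q t) = q 0" | "q (Suc t) = q 0"
      by (auto simp: doubleton_eq_iff)
    then show ?thesis
    proof cases
      case 1
      then have "t = 0" using lasso_start[OF q(1) t(1)] var_compl[of "q t"] by simp
      with 1 show ?thesis by simp
    next
      case 2
      then have "\<not> Suc t < j'" using lasso_start[OF q(1), of "Suc t"] by auto
      with t(1) have j: "j' = Suc t" by simp
      then have *: "compl (q i') = q 0" using 2 q(1) by (auto simp: lasso_def)
      then have "i' = 0" using lasso_start[OF q(1), of i'] q(1) var_compl[of "q i'"]
        by (simp add: lasso_def)
      with * show ?thesis by simp
    qed
  qed
qed

lemma finite_out: "finite (imp F `` {x})"
proof (rule finite_subset)
  show "imp F `` {x} \<subseteq> {y. var y \<in> vars F}" by (auto dest: imp_in_vars)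
qed (intro card_literals finite_vars cnf)

lemma out_degree_le_2: "card (imp F `` {x}) \<le> 2"
proof (cases "var x \<in> vars F")
  case True
  obtain l i j where "lasso F l i j" "l 0 = x" using ex_lasso_at[OF True] .
  then have "imp F `` {x} \<subseteq> {l 1, compl (l (j - 1))}" using out_neighbours_lasso by blast
  then have "card (imp F `` {x}) \<le> card {l 1, compl (l (j - 1))}" by (intro card_mono) auto
  also have "\<dots> \<le> 2" by (rule card_doubleton_le)
  finally show ?thesis .
next
  case False
  then have "imp F `` {x} = {}" by (auto dest: imp_in_vars)
  then show ?thesis by simp
qed

lemma out_neighbour_exists:
  assumes "var x \<in> vars F" obtains b where "(x, b) \<in> imp F"
proof -
  obtain l i j where "lasso F l i j" "l 0 = x" using ex_lasso_at[OF assms] .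
  then have "(x, l 1) \<in> imp F" by (auto simp: lasso_def)
  then show thesis using that by blast
qed

text \<open>A clause yields an arc and its contrapositive, which coincide for a unit clause.\<close>

lemma card_imp_le: "card (imp F) \<le> 2 * card F"
proof -
  have fin: "finite F" using cnf by (simp add: is_2cnf_def)
  define A where "A C = {(a, b). {compl a, b} = C}" for C :: "'v clause"
  have A: "card (A C) \<le> 2" if "C \<in> F" for C
  proof -
    obtain c d where C: "C = {compl c, d}" using clause_as_imp[OF cnf nonempty \<open>C \<in> F\<close>] .
    have "(a, b) \<in> {(c, d), (compl d, compl c)}" if "{compl a, b} = C" for a b
      using that unfolding C doubleton_eq_iff by (elim disjE conjE) auto
    then have "A C \<subseteq> {(c, d), (compl d, compl c)}" unfolding A_def by blast
    then have "card (A C) \<le> card {(c, d), (compl d, compl c)}" by (intro card_mono) auto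
    also have "\<dots> \<le> 2" by (rule card_doubleton_le)
    finally show ?thesis .
  qed
  have "imp F = (\<Union>C\<in>F. A C)" by (auto simp: A_def imp_def)
  then have "card (imp F) \<le> (\<Sum>C\<in>F. card (A C))" using card_UN_le[OF fin, of A] by simp
  also have "\<dots> \<le> (\<Sum>C\<in>F. 2)" using A by (intro sum_mono) auto
  finally show ?thesis by simp
qed

lemma card_imp_eq: "card (imp F) = (\<Sum>x | var x \<in> vars F. card (imp F `` {x}))"
proof -
  have "imp F = Sigma {x. var x \<in> vars F} (\<lambda>x. imp F `` {x})"
    by (auto dest: imp_in_vars)
  then show ?thesis
    using card_SigmaI[of "{x. var x \<in> vars F}" "\<lambda>x. imp F `` {x}"]
      card_literals(1)[OF finite_vars[OF cnf]] finite_out by simp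
qed

end

locale mu_2cnf_deficiency_ge_2 = mu_2cnf +
  assumes deficiency_ge_2: "card (vars F) + 2 \<le> card F"
begin

lemma no_unit: "{u} \<notin> F"
  using unit_clause_deficiency[of u] deficiency_ge_2 by auto

lemma imp_var_neq:
  assumes "(a, b) \<in> imp F" shows "var a \<noteq> var b"
proof
  assume "var a = var b"
  then have "a = b \<or> a = compl b" by (simp add: var_eq_iff)
  then show False
  proof
    assume "a = b" with imp_not_refl[OF cnf assms] show False by simp
  next
    assume "a = compl b" with assms no_unit[of b] show False by (simp add: imp_def)
  qed
qed

end

section \<open>Clause-sets without singular literals\<close>

text \<open>Out-neighbours of \<open>x\<close> correspond to clauses containing
  \<open>compl x\<close>, so the assumption says that every literal over \<open>vars F\<close>
  occurs in exactly two clauses.\<close>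

locale mu_2cnf_nonsingular = mu_2cnf_deficiency_ge_2 +
  assumes out_degree: "\<And>x. var x \<in> vars F \<Longrightarrow> card (imp F `` {x}) = 2"
begin

text \<open>A lasso that does not return to its start would leave \<open>l 1\<close> as the only
  out-neighbour of \<open>l 0\<close>.\<close>

lemma lasso_closed:
  assumes l: "lasso F l i j" shows "i = 0"
proof (rule ccontr)
  assume "i \<noteq> 0"
  then have "imp F `` {l 0} \<subseteq> {l 1}" using out_neighbours_lasso[OF l] by blast
  then have "card (imp F `` {l 0}) \<le> card {l 1}" by (intro card_mono) auto
  moreover have "var (l 0) \<in> vars F" using l lasso_var[OF l, of 0] by (auto simp: lasso_def)
  ultimately show False using out_degree by simp
qed

text \<open>Each of the \<open>2 * card (vars F)\<close> literals has two outgoing arcs and a clause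
  gives at most two arcs, whence the lower bound on \<open>card F\<close>. A lasso together with one
  at the complement of its start gives \<open>card F \<le> j + card (vars F)\<close>, so
  \<open>j\<close> has to be maximal.\<close>

lemma card_eq: "card F = 2 * card (vars F)"
  and lasso_covers: "lasso F l i j \<Longrightarrow> j = card (vars F)"
proof -
  have lower: "2 * card (vars F) \<le> card F"
    using card_imp_le card_imp_eq out_degree card_literals(2)[OF finite_vars[OF cnf]] by simp
  have upper: "card F \<le> j + card (vars F)" if l: "lasso F l i j" for l i j
  proof -
    have "var (l 0) \<in> vars F" using l lasso_var[OF l, of 0] by (auto simp: lasso_def)
    then obtain q i' j' where q: "lasso F q i' j'" "q 0 = compl (l 0)"
      using ex_lasso_at[of "compl (l 0)"] by auto
    show ?thesis using card_le_lassos[OF l q] lasso_length[OF q(1)] by linarith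
  qed
  show "lasso F l i j \<Longrightarrow> j = card (vars F)"
    using lower upper lasso_length by fastforce
  have "vars F \<noteq> {}"
  proof
    assume "vars F = {}"
    then have "F \<subseteq> {{}}" by (auto simp: vars_def)
    with nonempty have "F = {}" by blast
    with deficiency_ge_2 show False by simp
  qed
  then obtain x :: "'a lit" where "var x \<in> vars F" by (metis ex_in_conv lit.sel(1))
  then obtain l i j where l: "lasso F l i j" using ex_lasso_at by blast
  show "card F = 2 * card (vars F)" using lower upper[OF l] lasso_length[OF l] by linarith
qed

lemma lasso_vars:
  assumes "lasso F l i j" "v \<in> vars F"
  obtains t where "t < j" "v = var (l t)"
proof -
  have "(\<lambda>t. var (l t)) ` {..<j} = vars F"
  proof (rule card_subset_eq)
    show "finite (vars F)" by (intro finite_vars cnf)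
    show "(\<lambda>t. var (l t)) ` {..<j} \<subseteq> vars F" using lasso_var[OF assms(1)] by auto
    show "card ((\<lambda>t. var (l t)) ` {..<j}) = card (vars F)"
      using assms(1) lasso_covers[OF assms(1)] by (simp add: lasso_def card_image)
  qed
  with assms(2) show thesis using that by blast
qed

text \<open>A chord back from the end of a lasso closes a second lasso, which has to be as long as
  the first one.\<close>

lemma lasso_chord:
  assumes l: "lasso F l 0 n" and chord: "(l n, l t) \<in> imp F" and t: "t < n"
  shows "(l t, l n) \<in> imp F"
proof -
  \<comment> \<open>The new walk starts at \<open>compl (l t)\<close>, takes the contrapositive of
    the chord to \<open>l 0\<close>, and follows \<open>l\<close> up to \<open>l t\<close>.\<close>
  let ?l' = "case_nat (compl (l t)) l"
  have ln: "l n = compl (l 0)" using l by (simp add: lasso_def)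
  have "lasso F ?l' 0 (Suc t)"
    unfolding lasso_def
  proof (intro conjI allI impI)
    show "?l' (Suc t) = compl (?l' 0)" by simp
    show "(?l' u, ?l' (Suc u)) \<in> imp F" if "u < Suc t" for u
    proof (cases u)
      case 0
      then show ?thesis using imp_contrapos[OF chord] ln by simp
    next
      case (Suc w)
      then show ?thesis using that t l by (simp add: lasso_def)
    qed
    have "var (l u) \<noteq> var (l w)" if "u < w" "w < n" for u w
      using l that unfolding lasso_def inj_on_def by force
    then have "var (?l' u) \<noteq> var (?l' w)" if "u < w" "w < Suc t" for u w
      using that t by (cases u; cases w) (auto, metis)
    then show "inj_on (\<lambda>u. var (?l' u)) {..<Suc t}"
      by (intro linorder_inj_onI) auto
  qed simp
  then have "Suc t = card (vars F)" by (rule lasso_covers)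
  \<comment> \<open>Equal lengths leave \<open>t = n - 1\<close>, so the chord runs against the last
    step of the lasso.\<close>
  with lasso_covers[OF l] have "n = Suc t" by simp
  with l show ?thesis unfolding lasso_def by blast
qed

text \<open>Contraposing every step and reading backwards keeps both ends, since
  \<open>compl (l n) = l 0\<close>, and replaces the inner literals by their complements.\<close>

lemma lasso_reverse:
  assumes l: "lasso F l 0 n" shows "lasso F (\<lambda>t. compl (l (n - t))) 0 n"
  unfolding lasso_def
proof (intro conjI allI impI)
  show "0 < n" using l by (simp add: lasso_def)
  have ln: "l n = compl (l 0)" using l by (simp add: lasso_def)
  then show "compl (l (n - n)) = compl (compl (l (n - 0)))" by simp
  show "(compl (l (n - t)), compl (l (n - Suc t))) \<in> imp F" if "t < n" for t
  proof -
    have "(l (n - Suc t), l (Suc (n - Suc t))) \<in> imp F" using l that by (simp add: lasso_def)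
    moreover have "Suc (n - Suc t) = n - t" using that by simp
    ultimately show ?thesis by (simp add: imp_contrapos)
  qed
  have *: "var (l u) \<noteq> var (l w)" if "u < w" "w < n" for u w
    using l that unfolding lasso_def inj_on_def by force
  have "var (l (n - u)) \<noteq> var (l (n - w))" if "u < w" "w < n" for u w
  \<comment> \<open>Index 0 refers to \<open>l n\<close>, which lies outside the range of
    injectivity and is compared through \<open>l 0\<close>.\<close>
  proof (cases "u = 0")
    case True
    then show ?thesis using *[of 0 "n - w"] that ln by simp
  next
    case False
    then show ?thesis using *[of "n - w" "n - u"] that by (metis diff_less_mono2 diff_less not_gr_zero order.strict_trans zero_less_diff)
  qed
  then show "inj_on (\<lambda>t. var (compl (l (n - t)))) {..<n}"
    by (intro linorder_inj_onI) auto
qed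

text \<open>A lasso at \<open>compl x\<close> ends in \<open>x\<close> and runs through all
  variables, so it contains \<open>y\<close> or \<open>compl y\<close>. The arc is then a chord from
  the end of this lasso or of its reversal.\<close>

lemma imp_sym:
  assumes "(x, y) \<in> imp F" shows "(y, x) \<in> imp F"
proof -
  let ?n = "card (vars F)"
  have xy: "var x \<in> vars F" "var y \<in> vars F" using imp_in_vars[OF assms] by auto
  obtain l i j where "lasso F l i j" and l0: "l 0 = compl x"
    using ex_lasso_at[of "compl x"] xy(1) by auto
  then have l: "lasso F l 0 ?n" using lasso_closed lasso_covers by metis
  then have ln: "l ?n = x" using l0 by (simp add: lasso_def)
  obtain t where t: "t < ?n" "var y = var (l t)" using lasso_vars[OF l xy(2)] .
  \<comment> \<open>This makes \<open>?n - t\<close> an index below \<open>?n\<close>, as needed for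
    a chord of the reversed lasso.\<close>
  have "t \<noteq> 0" using t(2) l0 imp_var_neq[OF assms] by (metis var_compl)
  from t(2) consider "y = l t" | "y = compl (l t)" by (auto simp: var_eq_iff)
  then show ?thesis
  proof cases
    case 1
    then show ?thesis using lasso_chord[OF l _ t(1)] assms ln by simp
  next
    case 2
    then show ?thesis
      using lasso_chord[OF lasso_reverse[OF l], of "?n - t"] assms l0 t(1) \<open>t \<noteq> 0\<close> by simp
  qed
qed

end
section \<open>Splittings up to isomorphism\<close>

lemma wf_digraph_with_proj: "wf_digraph (with_proj G) \<longleftrightarrow> parcs G \<subseteq> pverts G \<times> pverts G"
  by (auto simp: wf_digraph_def)

text \<open>Arcs of \<open>with_proj\<close> are vertex pairs, so the vertex map forces the arc map.
  This rule and its converse reduce isomorphisms to injections on vertices.\<close>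

lemma digraph_iso_with_projI:
  assumes "parcs G \<subseteq> pverts G \<times> pverts G" "inj_on f (pverts G)"
    "pverts H = f ` pverts G" "parcs H = map_prod f f ` parcs G"
  shows "digraph_iso (with_proj G) (with_proj H)"
  unfolding digraph_iso_def
proof (intro exI conjI)
  let ?h = "\<lparr>iso_verts = f, iso_arcs = map_prod f f, iso_head = snd, iso_tail = fst\<rparr>"
  have "inj_on (map_prod f f) (parcs G)"
    using map_prod_inj_on[OF assms(2,2)] assms(1) by (rule inj_on_subset)
  then show "pre_digraph.digraph_isomorphism (with_proj G) ?h"
    using assms(1,2) by (auto simp: pre_digraph.digraph_isomorphism_def wf_digraph_with_proj)
  show "with_proj H = app_iso ?h (with_proj G)"
    using assms(3,4) by (simp add: app_iso_def with_proj_def)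
qed

lemma digraph_iso_with_projE:
  assumes "digraph_iso (with_proj G) (with_proj H)"
  obtains f where "parcs G \<subseteq> pverts G \<times> pverts G" "inj_on f (pverts G)"
    "pverts H = f ` pverts G" "parcs H = map_prod f f ` parcs G"
proof -
  obtain h where h: "pre_digraph.digraph_isomorphism (with_proj G) h"
      "with_proj H = app_iso h (with_proj G)"
    using assms unfolding digraph_iso_def by blast
  have eq: "pverts H = iso_verts h ` pverts G" "parcs H = iso_arcs h ` parcs G"
      "fst = iso_tail h" "snd = iso_head h"
    using h(2) unfolding with_proj_def app_iso_def by simp_all
  have "iso_arcs h a = map_prod (iso_verts h) (iso_verts h) a" if "a \<in> parcs G" for a
    using h(1) that unfolding pre_digraph.digraph_isomorphism_def eq(3,4)[symmetric]
    by (cases a; cases "iso_arcs h a") auto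
  then have "parcs H = map_prod (iso_verts h) (iso_verts h) ` parcs G"
    using eq(2) by (simp cong: image_cong)
  moreover have "parcs G \<subseteq> pverts G \<times> pverts G" "inj_on (iso_verts h) (pverts G)"
    using h(1) by (auto simp: pre_digraph.digraph_isomorphism_def wf_digraph_with_proj)
  ultimately show thesis using that eq(1) by blast
qed

text \<open>\<open>wdc_nat\<close> splits only digraphs on natural numbers. The split is repeated on
  the isomorphic copy \<open>H\<close>, where finiteness provides a fresh number, and the
  isomorphism is extended to the new vertex.\<close>

lemma weak_double_cycle_split_arc:
  assumes G: "weak_double_cycle m G" "finite (pverts G)"
    and xy: "(x, y) \<in> parcs G" and w: "w \<notin> pverts G"
  shows "weak_double_cycle m (split_arc G x y w)"
proof -
  obtain H where H: "wdc_nat m H" "digraph_iso (with_proj G) (with_proj H)"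
    using G(1) unfolding weak_double_cycle_def by blast
  obtain f where f: "parcs G \<subseteq> pverts G \<times> pverts G" "inj_on f (pverts G)"
    "pverts H = f ` pverts G" "parcs H = map_prod f f ` parcs G"
    using digraph_iso_with_projE[OF H(2)] .
  have "finite (pverts H)" using G(2) f(3) by simp
  then obtain w' where w': "w' \<notin> pverts H" using ex_new_if_finite infinite_UNIV_nat by metis
  define g where "g = f(w := w')"
  have g: "g v = f v" if "v \<in> pverts G" for v using that w by (auto simp: g_def)
  have xyG: "x \<in> pverts G" "y \<in> pverts G" using xy f(1) by auto
  have "inj_on (map_prod f f) (parcs G)"
    using map_prod_inj_on[OF f(2,2)] f(1) by (rule inj_on_subset)
  then have "map_prod f f ` (parcs G - {(x, y)}) = map_prod f f ` parcs G - map_prod f f ` {(x, y)}"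
    using xy by (intro inj_on_image_set_diff) auto
  moreover have "map_prod g g ` (parcs G - {(x, y)}) = map_prod f f ` (parcs G - {(x, y)})"
    using f(1) g by (intro image_cong) auto
  ultimately have "parcs (split_arc H (f x) (f y) w') = map_prod g g ` parcs (split_arc G x y w)"
    using g[OF xyG(1)] g[OF xyG(2)] f(4) by (simp add: split_arc_def image_Un g_def)
  moreover have "pverts (split_arc H (f x) (f y) w') = g ` pverts (split_arc G x y w)"
    using g f(3) by (simp add: split_arc_def cong: image_cong) (simp add: g_def)
  moreover have "inj_on g (pverts (split_arc G x y w))"
    using f(2,3) w w' g by (auto simp: split_arc_def inj_on_def g_def)
  moreover have "parcs (split_arc G x y w) \<subseteq> pverts (split_arc G x y w) \<times> pverts (split_arc G x y w)"
    using f(1) xyG by (auto simp: split_arc_def)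
  ultimately have "digraph_iso (with_proj (split_arc G x y w)) (with_proj (split_arc H (f x) (f y) w'))"
    by (intro digraph_iso_with_projI[where f = g])
  moreover have "wdc_nat m (split_arc H (f x) (f y) w')"
    using H(1) w' xy f(4) by (intro wdc_nat.arc) force+
  ultimately show ?thesis unfolding weak_double_cycle_def by blast
qed

text \<open>One of the two new vertices may reuse the name of the split vertex.\<close>

lemma weak_double_cycle_split_vertex:
  assumes G: "weak_double_cycle m G" "finite (pverts G)"
    and x: "x \<in> pverts G" "(x, x) \<notin> parcs G"
    and uw: "u \<notin> pverts G - {x}" "w \<notin> pverts G - {x}" "u \<noteq> w"
  shows "weak_double_cycle m (split_vertex G x u w)"
proof -
  obtain H where H: "wdc_nat m H" "digraph_iso (with_proj G) (with_proj H)"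
    using G(1) unfolding weak_double_cycle_def by blast
  obtain f where f: "parcs G \<subseteq> pverts G \<times> pverts G" "inj_on f (pverts G)"
    "pverts H = f ` pverts G" "parcs H = map_prod f f ` parcs G"
    using digraph_iso_with_projE[OF H(2)] .
  have "finite (pverts H)" using G(2) f(3) by simp
  then obtain u' where u': "u' \<notin> pverts H" using ex_new_if_finite infinite_UNIV_nat by metis
  have "finite (insert u' (pverts H))" using \<open>finite (pverts H)\<close> by simp
  then obtain w' where w': "w' \<notin> insert u' (pverts H)"
    using ex_new_if_finite infinite_UNIV_nat by metis
  let ?G = "split_vertex G x u w" and ?H = "split_vertex H (f x) u' w'"
  \<comment> \<open>\<open>u\<close> or \<open>w\<close> may be \<open>x\<close> itself, so
    \<open>g\<close> agrees with \<open>f\<close> only away from \<open>x\<close>. In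
    \<open>H\<close> both new vertices are fresh, as \<open>wdc_nat.vertex\<close> demands.\<close>
  define g where "g = f(u := u', w := w')"
  have g: "g v = f v" if "v \<in> pverts G - {x}" for v using that uw by (auto simp: g_def)
  have guw: "g u = u'" "g w = w'" using uw(3) by (auto simp: g_def)
  have f_x: "f a = f x \<longleftrightarrow> a = x" if "a \<in> pverts G" for a
    using that f(2) x(1) by (auto dest: inj_onD)
  have fV: "c \<in> pverts G" "d \<in> pverts G" if "(c, d) \<in> parcs G" for c d
    using that f(1) by auto
  have arcs: "(a, b) \<in> parcs H \<longleftrightarrow> (\<exists>c d. (c, d) \<in> parcs G \<and> a = f c \<and> b = f d)" for a b
    unfolding f(4) by force
  have "(a, b) \<in> parcs H \<and> a \<noteq> f x \<and> b \<noteq> f x \<longleftrightarrow>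
      (\<exists>c d. (c, d) \<in> parcs G \<and> c \<noteq> x \<and> d \<noteq> x \<and> a = f c \<and> b = f d)" for a b
    unfolding arcs using f_x fV by metis
  then have "{(a, b). (a, b) \<in> parcs H \<and> a \<noteq> f x \<and> b \<noteq> f x} =
      map_prod f f ` {(a, b). (a, b) \<in> parcs G \<and> a \<noteq> x \<and> b \<noteq> x}"
    by (simp only: set_eq_iff) force
  also have "\<dots> = map_prod g g ` {(a, b). (a, b) \<in> parcs G \<and> a \<noteq> x \<and> b \<noteq> x}"
    using f(1) g by (intro image_cong) auto
  finally have 1: "{(a, b). (a, b) \<in> parcs H \<and> a \<noteq> f x \<and> b \<noteq> f x} =
    map_prod g g ` {(a, b). (a, b) \<in> parcs G \<and> a \<noteq> x \<and> b \<noteq> x}" .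
  have "(a, f x) \<in> parcs H \<longleftrightarrow> (\<exists>c. (c, x) \<in> parcs G \<and> a = f c)" for a
    unfolding arcs using f_x fV by metis
  then have "{a. (a, f x) \<in> parcs H} = f ` {a. (a, x) \<in> parcs G}" by auto
  \<comment> \<open>Without a loop at \<open>x\<close>, its neighbours differ from \<open>x\<close>,
    and there \<open>f\<close> and \<open>g\<close> agree.\<close>
  also have "\<dots> = g ` {a. (a, x) \<in> parcs G}"
    using fV g x(2) by (intro image_cong refl) (metis Diff_iff mem_Collect_eq singletonD)
  finally have in_arcs: "{a. (a, f x) \<in> parcs H} = g ` {a. (a, x) \<in> parcs G}" .
  have "{(a, u') | a. (a, f x) \<in> parcs H} = (\<lambda>a. (a, u')) ` {a. (a, f x) \<in> parcs H}" by auto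
  also have "\<dots> = map_prod g g ` (\<lambda>a. (a, u)) ` {a. (a, x) \<in> parcs G}"
    unfolding in_arcs image_image using guw(1) by simp
  also have "(\<lambda>a. (a, u)) ` {a. (a, x) \<in> parcs G} = {(a, u) | a. (a, x) \<in> parcs G}" by auto
  finally have 2: "{(a, u') | a. (a, f x) \<in> parcs H} = map_prod g g ` {(a, u) | a. (a, x) \<in> parcs G}" .
  have "(f x, b) \<in> parcs H \<longleftrightarrow> (\<exists>d. (x, d) \<in> parcs G \<and> b = f d)" for b
    unfolding arcs using f_x fV by metis
  then have "{b. (f x, b) \<in> parcs H} = f ` {b. (x, b) \<in> parcs G}" by auto
  also have "\<dots> = g ` {b. (x, b) \<in> parcs G}"
    using fV g x(2) by (intro image_cong refl) (metis Diff_iff mem_Collect_eq singletonD)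
  finally have out_arcs: "{b. (f x, b) \<in> parcs H} = g ` {b. (x, b) \<in> parcs G}" .
  have "{(w', b) | b. (f x, b) \<in> parcs H} = Pair w' ` {b. (f x, b) \<in> parcs H}" by auto
  also have "\<dots> = map_prod g g ` Pair w ` {b. (x, b) \<in> parcs G}"
    unfolding out_arcs image_image using guw(2) by simp
  also have "Pair w ` {b. (x, b) \<in> parcs G} = {(w, b) | b. (x, b) \<in> parcs G}" by auto
  finally have 3: "{(w', b) | b. (f x, b) \<in> parcs H} = map_prod g g ` {(w, b) | b. (x, b) \<in> parcs G}" .
  have "f ` (pverts G - {x}) = pverts H - {f x}"
    using f_x f(3) by auto
  then have gV: "g ` (pverts G - {x}) = pverts H - {f x}"
    using image_cong[OF refl g, of "pverts G - {x}"] by simp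
  have "parcs ?H = map_prod g g ` parcs ?G"
    unfolding split_vertex_def pair_pre_digraph.simps image_Un 1 2 3 using guw by simp
  moreover have "pverts ?H = g ` pverts ?G"
    unfolding split_vertex_def pair_pre_digraph.simps image_Un gV using guw by simp
  moreover have "inj_on g (pverts ?G)"
  proof -
    have "inj_on g (pverts G - {x})"
      using f(2) g by (auto simp: inj_on_def)
    then have "inj_on g (insert u (insert w (pverts G - {x})))"
      using uw u' w' guw unfolding inj_on_insert by (simp add: gV)
    then show ?thesis by (simp add: split_vertex_def insert_commute)
  qed
  moreover have "parcs ?G \<subseteq> pverts ?G \<times> pverts ?G"
    using f(1) x(2) by (auto simp: split_vertex_def)
  ultimately have "digraph_iso (with_proj ?G) (with_proj ?H)"
    by (intro digraph_iso_with_projI[where f = g])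
  moreover have "wdc_nat m ?H"
    using H(1) u' w' x(1) f(3) by (intro wdc_nat.vertex) auto
  ultimately show ?thesis unfolding weak_double_cycle_def by blast
qed

lemma weak_double_cycle_of_double_cycle:
  assumes m: "3 \<le> m" and inj: "inj_on g {1..m}"
    and verts: "pverts G = g ` {1..m}"
    and arcs: "parcs G = (\<Union>i\<in>{1..m}. {(g i, g (i mod m + 1)), (g (i mod m + 1), g i)})"
  shows "weak_double_cycle m G"
proof -
  let ?D = "standard_double_cycle m"
  have D: "parcs ?D \<subseteq> pverts ?D \<times> pverts ?D"
    using m by (auto simp: standard_double_cycle_def Suc_le_eq)
  have "parcs G = map_prod g g ` parcs ?D"
    unfolding arcs by (auto simp: standard_double_cycle_def image_UN)
  then have "digraph_iso (with_proj ?D) (with_proj G)"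
    using inj verts by (intro digraph_iso_with_projI D) (auto simp: standard_double_cycle_def)
  then have "digraph_iso (with_proj G) (with_proj ?D)"
    using D digraph_iso_swap[of "with_proj ?D"] wf_digraph_with_proj[of ?D] by blast
  moreover have "double_cycle m ?D"
    unfolding double_cycle_def using m D
    by (intro conjI digraph_iso_with_projI[where f = id]) (auto simp: prod.map_id0)
  ultimately show ?thesis
    unfolding weak_double_cycle_def by (blast intro: wdc_nat.base)
qed

section \<open>The double cycle of a nonsingular clause-set\<close>

context mu_2cnf_nonsingular
begin

text \<open>A lasso followed by the complements of its literals is a closed walk through all
  literals. Symmetry of \<open>imp F\<close> supplies the reverse arcs, and out-degree 2 leaves room
  for no others.\<close>

lemma weak_double_cycle_idg: "weak_double_cycle (2 * card (vars F)) (idg F)"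
proof -
  define n where "n = card (vars F)"
  have n: "2 \<le> n" using card_eq deficiency_ge_2 by (simp add: n_def)
  then have "vars F \<noteq> {}" by (auto simp: n_def)
  then obtain x :: "'a lit" where "var x \<in> vars F" by (metis ex_in_conv lit.sel(1))
  then obtain l i j where "lasso F l i j" using ex_lasso_at by blast
  then have l: "lasso F l 0 n" using lasso_closed lasso_covers unfolding n_def by metis
  then have ln: "l n = compl (l 0)" and step: "\<And>t. t < n \<Longrightarrow> (l t, l (Suc t)) \<in> imp F"
    by (simp_all add: lasso_def)
  have rev_step: "(compl (l t), compl (l (Suc t))) \<in> imp F" if "t < n" for t
    using imp_sym[OF imp_contrapos[OF step[OF that]]] .
  \<comment> \<open>The enumeration runs from \<open>l 1\<close> to \<open>l n = compl (l 0)\<close>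
    and on through the complements to \<open>compl (l n) = l 0\<close>.\<close>
  define g where "g i = (if i \<le> n then l i else compl (l (i - n)))" for i
  have succ: "(g i, g (i mod (2 * n) + 1)) \<in> imp F" if i: "i \<in> {1..2 * n}" for i
  proof -
    consider "i < n" | "i = n" | "n < i" "i < 2 * n" | "i = 2 * n" using i by fastforce
    then show ?thesis
    proof cases
      case 1 then show ?thesis using step[of i] by (simp add: g_def)
    next
      case 2 then show ?thesis using rev_step[of 0] n ln by (simp add: g_def)
    next
      case 3
      then show ?thesis using rev_step[of "i - n"] by (simp add: g_def Suc_diff_le)
    next
      case 4 then show ?thesis using step[of 0] n ln by (simp add: g_def)
    qed
  qed
  have inj: "inj_on g {1..2 * n}"
  proof -
    have *: "u = w" if "var (l u) = var (l w)" "u \<in> {1..n}" "w \<in> {1..n}" for u w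
    proof -
      have inj: "inj_on (\<lambda>t. var (l t)) {..<n}" using l by (simp add: lasso_def)
      \<comment> \<open>Reduction mod \<open>n\<close> sends index \<open>n\<close> to 0, which has
        the same variable, and lands in the range where injectivity is known.\<close>
      have "var (l (u mod n)) = var (l (w mod n))"
        using that ln by (cases "u = n"; cases "w = n") auto
      then have "u mod n = w mod n" using inj_onD[OF inj] n by simp
      then show ?thesis using that by (cases "u = n"; cases "w = n") auto
    qed
    show ?thesis
    proof (rule inj_onI)
      fix u w assume uw: "u \<in> {1..2 * n}" "w \<in> {1..2 * n}" "g u = g w"
      define u' w' where "u' = (if u \<le> n then u else u - n)" and "w' = (if w \<le> n then w else w - n)"
      have "var (g u) = var (l u')" "var (g w) = var (l w')" by (simp_all add: g_def u'_def w'_def)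
      then have "u' = w'" using uw by (intro *) (auto simp: u'_def w'_def)
      moreover have "u \<le> n \<longleftrightarrow> w \<le> n"
      proof (rule ccontr)
        assume "\<not> (u \<le> n \<longleftrightarrow> w \<le> n)"
        then have "g u = compl (g w)" using \<open>u' = w'\<close> by (auto simp: g_def u'_def w'_def split: if_splits)
        with uw(3) show False by simp
      qed
      ultimately show "u = w" by (auto simp: u'_def w'_def split: if_splits)
    qed
  qed
  have verts: "g ` {1..2 * n} = {x. var x \<in> vars F}"
  proof (rule card_subset_eq)
    show "finite {x. var x \<in> vars F}" by (intro card_literals finite_vars cnf)
    show "g ` {1..2 * n} \<subseteq> {x. var x \<in> vars F}" using succ imp_in_vars by blast
    show "card (g ` {1..2 * n}) = card {x. var x \<in> vars F}"
      using card_image[OF inj] card_literals(2)[OF finite_vars[OF cnf]] by (simp add: n_def)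
  qed
  let ?s = "\<lambda>i. i mod (2 * n) + 1"
  let ?A = "\<Union>i\<in>{1..2 * n}. {(g i, g (?s i)), (g (?s i), g i)}"
  have "(a, b) \<in> ?A" if ab: "(a, b) \<in> imp F" for a b
  proof -
    obtain i where i: "i \<in> {1..2 * n}" "a = g i"
      using imp_in_vars[OF ab] verts by blast
    \<comment> \<open>\<open>p\<close> is the cyclic predecessor of \<open>i\<close>. It differs
      from the successor because the cycle has length at least 4, so the two exhaust the
      out-neighbours of \<open>a\<close>.\<close>
    define p where "p = (if i = 1 then 2 * n else i - 1)"
    have p: "p \<in> {1..2 * n}" "?s p = i" using i n by (auto simp: p_def)
    have si: "?s i \<in> {1..2 * n}" using n by (auto simp: Suc_le_eq)
    have "p \<noteq> ?s i"
    proof (cases "i = 2 * n")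
      case True
      then show ?thesis using n by (simp add: p_def)
    next
      case False
      then have "?s i = i + 1" using i by simp
      then show ?thesis using n i by (auto simp: p_def)
    qed
    then have "g p \<noteq> g (?s i)" using inj_onD[OF inj _ p(1) si] by blast
    then have "card {g p, g (?s i)} = 2" by simp
    moreover have "{g p, g (?s i)} \<subseteq> imp F `` {a}"
      using succ[OF i(1)] imp_sym[OF succ[OF p(1)]] p(2) i(2) by simp
    moreover have "card (imp F `` {a}) = 2" using out_degree imp_in_vars[OF ab] by simp
    ultimately have "{g p, g (?s i)} = imp F `` {a}" by (intro card_subset_eq finite_out) auto
    then have "b = g p \<or> b = g (?s i)" using ab by blast
    then show ?thesis
    proof
      assume "b = g p"
      then have "(a, b) = (g (?s p), g p)" using i(2) p(2) by simp
      then show ?thesis using p(1) by blast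
    next
      assume "b = g (?s i)"
      then show ?thesis using i by blast
    qed
  qed
  moreover have "?A \<subseteq> imp F" using succ imp_sym by blast
  ultimately have arcs: "imp F = ?A" by auto
  have "3 \<le> 2 * n" using n by simp
  from weak_double_cycle_of_double_cycle[OF this inj
      trans[OF pverts_idg verts[symmetric]] trans[OF parcs_idg arcs]]
  show ?thesis by (simp add: n_def)
qed

end

section \<open>Elimination of a singular literal\<close>

text \<open>In terms of clauses, \<open>{x, y}\<close> is the only clause containing
  \<open>x\<close>.\<close>

locale mu_2cnf_singular = mu_2cnf_deficiency_ge_2 +
  fixes x y
  assumes singular: "imp F `` {compl x} = {y}"
begin

definition untouched :: "'a clause set" where
  "untouched = {C \<in> F. x \<notin> C \<and> compl x \<notin> C}"

definition Z :: "'a lit set" where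
  "Z = imp F `` {x}"

text \<open>This is Davis-Putnam elimination of the variable of \<open>x\<close>: each clause
  \<open>{compl x, z}\<close> is resolved with \<open>{x, y}\<close>, the only clause containing
  \<open>x\<close>.\<close>

definition resolved :: "'a clause set" where
  "resolved = untouched \<union> (\<lambda>z. {z, y}) ` Z"

lemma xy_imp: "(compl x, y) \<in> imp F" and xy_clause: "{x, y} \<in> F"
proof -
  show "(compl x, y) \<in> imp F" using singular by blast
  then show "{x, y} \<in> F" by (simp add: imp_def)
qed

lemma var_y: "var y \<noteq> var x"
  using imp_var_neq[OF xy_imp] by simp

lemma var_Z: "z \<in> Z \<Longrightarrow> var z \<noteq> var x"
  using imp_var_neq[of x z] by (auto simp: Z_def)

lemma Z_clause: "z \<in> Z \<longleftrightarrow> {compl x, z} \<in> F"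
  by (simp add: Z_def imp_def)

lemma finite_Z: "finite Z"
  unfolding Z_def by (rule finite_out)

lemma Z_nonempty: "Z \<noteq> {}"
proof -
  obtain b where "(x, b) \<in> imp F" using out_neighbour_exists[of x] imp_in_vars[OF xy_imp] by auto
  then show ?thesis by (auto simp: Z_def)
qed

lemma clause_with_literal:
  assumes "C \<in> F" "w \<in> C"
  obtains z where "C = {w, z}" "(compl w, z) \<in> imp F"
proof -
  obtain a b where C: "C = {compl a, b}" "(a, b) \<in> imp F"
    using clause_as_imp[OF cnf nonempty assms(1)] .
  from assms(2) C(1) consider "w = compl a" | "w = b" by auto
  then show thesis
  proof cases
    case 1 with C show thesis by (intro that[of b]) auto
  next
    case 2 with C show thesis using imp_contrapos[OF C(2)] by (intro that[of "compl a"]) auto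
  qed
qed

lemma clause_cases:
  assumes "C \<in> F"
  obtains "C = {x, y}" | z where "z \<in> Z" "C = {compl x, z}" | "C \<in> untouched"
proof -
  consider "x \<in> C" | "compl x \<in> C" | "C \<in> untouched" using assms by (auto simp: untouched_def)
  then show thesis
  proof cases
    case 1
    obtain z where "C = {x, z}" "(compl x, z) \<in> imp F" using clause_with_literal[OF assms 1] .
    moreover from this have "z = y" using singular by blast
    ultimately show thesis using that(1) by simp
  next
    case 2
    obtain z where "C = {compl x, z}" "(compl (compl x), z) \<in> imp F"
      using clause_with_literal[OF assms 2] .
    then show thesis using that(2)[of z] by (simp add: Z_def)
  qed (rule that(3))
qed

lemma untouched_var:
  assumes "C \<in> untouched" "w \<in> C" shows "var w \<noteq> var x"
proof
  assume "var w = var x"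
  then have "w = x \<or> w = compl x" by (simp add: var_eq_iff)
  with assms show False by (auto simp: untouched_def)
qed

lemma removed_clause_model:
  assumes "C \<in> F"
  obtains \<phi> where "\<forall>D\<in>F - {C}. \<exists>w\<in>D. lit_true \<phi> w" "\<forall>w\<in>C. \<not> lit_true \<phi> w"
proof -
  obtain \<phi> where \<phi>: "\<forall>D\<in>F - {C}. \<exists>w\<in>D. lit_true \<phi> w"
    using mu assms by (auto simp: minimally_unsatisfiable_def satisfiable_def)
  have "\<not> (\<exists>w\<in>C. lit_true \<phi> w)"
  proof
    assume "\<exists>w\<in>C. lit_true \<phi> w"
    with \<phi> have "\<forall>D\<in>F. \<exists>w\<in>D. lit_true \<phi> w" by (metis DiffI singletonD)
    then show False using mu unfolding minimally_unsatisfiable_def satisfiable_def by metis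
  qed
  with \<phi> show thesis using that by blast
qed

lemma no_model: "\<not> (\<forall>D\<in>F. \<exists>w\<in>D. lit_true \<phi> w)"
  using mu unfolding minimally_unsatisfiable_def satisfiable_def by metis

lemma resolvent_true:
  assumes "\<exists>w\<in>{compl x, z}. lit_true \<phi> w" "\<exists>w\<in>{x, y}. lit_true \<phi> w"
  shows "\<exists>w\<in>{z, y}. lit_true \<phi> w"
  using assms by auto

text \<open>The resolvent follows from its two parents, so as a member of \<open>F\<close> it would
  be redundant, against minimality.\<close>

lemma resolvent_notin:
  assumes "z \<in> Z" shows "{z, y} \<notin> F"
proof
  assume zy: "{z, y} \<in> F"
  obtain \<phi> where \<phi>: "\<forall>D\<in>F - {{z, y}}. \<exists>w\<in>D. lit_true \<phi> w" "\<forall>w\<in>{z, y}. \<not> lit_true \<phi> w"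
    using removed_clause_model[OF zy] .
  have "x \<notin> {z, y}" "compl x \<notin> {z, y}" using var_Z[OF assms] var_y by auto
  then have in_F: "{compl x, z} \<in> F - {{z, y}}" "{x, y} \<in> F - {{z, y}}"
    using assms xy_clause by (auto simp: Z_clause)
  show False
    using resolvent_true[OF bspec[OF \<phi>(1) in_F(1)] bspec[OF \<phi>(1) in_F(2)]] \<phi>(2) by blast
qed

text \<open>If \<open>{compl x, compl y}\<close> were a clause, then an assignment falsifying only this clause could
  be repaired by making \<open>x\<close> false, as \<open>y\<close> satisfies the only clause containing \<open>x\<close>.\<close>

lemma compl_y_notin_Z: "compl y \<notin> Z"
proof
  assume "compl y \<in> Z"
  then have D: "{compl x, compl y} \<in> F" by (simp add: Z_clause)
  obtain \<phi> where \<phi>: "\<forall>D\<in>F - {{compl x, compl y}}. \<exists>w\<in>D. lit_true \<phi> w"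
      "\<forall>w\<in>{compl x, compl y}. \<not> lit_true \<phi> w"
    using removed_clause_model[OF D] .
  obtain \<psi> where \<psi>: "lit_true \<psi> x \<longleftrightarrow> False"
      "\<And>w. var w \<noteq> var x \<Longrightarrow> lit_true \<psi> w \<longleftrightarrow> lit_true \<phi> w"
    using override_literal[of x False \<phi>] by blast
  have "\<exists>w\<in>C. lit_true \<psi> w" if C: "C \<in> F" for C
    using C
  proof (cases rule: clause_cases)
    case 1
    then show ?thesis using \<psi>(2)[OF var_y] \<phi>(2) by simp
  next
    case (2 z)
    then show ?thesis using \<psi>(1) by simp
  next
    case 3
    then have "C \<noteq> {compl x, compl y}" by (auto simp: untouched_def)
    with C \<phi>(1) obtain w where "w \<in> C" "lit_true \<phi> w" by blast
    then show ?thesis using \<psi>(2) untouched_var[OF 3] by blast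
  qed
  then show False using no_model by blast
qed

text \<open>A model of the resolved set extends to \<open>F\<close> by giving \<open>x\<close> the
  opposite value of \<open>y\<close>: if \<open>x\<close> becomes true, the resolvent
  \<open>{z, y}\<close> forces \<open>z\<close>.\<close>

lemma resolved_unsat: "\<not> satisfiable resolved"
proof
  assume "satisfiable resolved"
  then obtain \<phi> where \<phi>: "\<forall>C\<in>resolved. \<exists>w\<in>C. lit_true \<phi> w"
    unfolding satisfiable_def by blast
  obtain \<psi> where \<psi>: "lit_true \<psi> x \<longleftrightarrow> \<not> lit_true \<phi> y"
      "\<And>w. var w \<noteq> var x \<Longrightarrow> lit_true \<psi> w \<longleftrightarrow> lit_true \<phi> w"
    using override_literal[of x "\<not> lit_true \<phi> y" \<phi>] by blast
  have "\<exists>w\<in>C. lit_true \<psi> w" if C: "C \<in> F" for C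
    using C
  proof (cases rule: clause_cases)
    case 1
    then show ?thesis using \<psi>(2)[OF var_y] \<psi>(1) by auto
  next
    case (2 z)
    then have "{z, y} \<in> resolved" by (auto simp: resolved_def)
    with \<phi> have "\<exists>w\<in>{z, y}. lit_true \<phi> w" by blast
    then show ?thesis using 2(2) \<psi>(1) \<psi>(2)[OF var_Z[OF 2(1)]] by auto
  next
    case 3
    then have "C \<in> resolved" by (simp add: resolved_def)
    with \<phi> obtain w where "w \<in> C" "lit_true \<phi> w" by blast
    then show ?thesis using \<psi>(2) untouched_var[OF 3] by blast
  qed
  then show False using no_model by blast
qed

text \<open>Models come from \<open>F\<close> with one clause removed: the same clause if it is
  untouched, the parent \<open>{compl x, z0}\<close> if it is a resolvent. All other resolvents keep
  both parents and stay true.\<close>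

lemma resolved_minimal:
  assumes "C \<in> resolved" shows "satisfiable (resolved - {C})"
proof -
  have x_in: "x \<in> {x, y}" "compl x \<in> {compl x, z}" for z by auto
  have "C \<in> untouched \<or> (\<exists>z\<in>Z. C = {z, y})" using assms by (auto simp: resolved_def)
  then show ?thesis
  proof
    assume C: "C \<in> untouched"
    then have "C \<in> F" by (simp add: untouched_def)
    then obtain \<phi> where \<phi>: "\<forall>D\<in>F - {C}. \<exists>w\<in>D. lit_true \<phi> w"
      using removed_clause_model by blast
    have "\<exists>w\<in>D. lit_true \<phi> w" if D: "D \<in> resolved - {C}" for D
    proof (cases "D \<in> untouched")
      case True
      then show ?thesis using \<phi> D by (auto simp: untouched_def)
    next
      case False
      then obtain z where z: "z \<in> Z" "D = {z, y}" using D by (auto simp: resolved_def)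
      have "{x, y} \<noteq> C" "{compl x, z} \<noteq> C" using C x_in by (auto simp: untouched_def)
      then have in_F: "{compl x, z} \<in> F - {C}" "{x, y} \<in> F - {C}"
        using z xy_clause by (auto simp: Z_clause)
      show ?thesis
        unfolding z(2) by (rule resolvent_true[OF bspec[OF \<phi> in_F(1)] bspec[OF \<phi> in_F(2)]])
    qed
    then show ?thesis unfolding satisfiable_def by blast
  next
    assume "\<exists>z\<in>Z. C = {z, y}"
    then obtain z0 where z0: "z0 \<in> Z" "C = {z0, y}" by blast
    then have z0F: "{compl x, z0} \<in> F" by (simp add: Z_clause)
    obtain \<phi> where \<phi>: "\<forall>D\<in>F - {{compl x, z0}}. \<exists>w\<in>D. lit_true \<phi> w"
      using removed_clause_model[OF z0F] by blast
    have "\<exists>w\<in>D. lit_true \<phi> w" if D: "D \<in> resolved - {C}" for D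
    proof (cases "D \<in> untouched")
      case True
      then have "D \<in> F" "D \<noteq> {compl x, z0}" by (auto simp: untouched_def)
      then show ?thesis using \<phi> by blast
    next
      case False
      then obtain z where z: "z \<in> Z" "D = {z, y}" using D by (auto simp: resolved_def)
      then have "z \<noteq> z0" using D z0 by auto
      then have "{compl x, z} \<noteq> {compl x, z0}" by (auto simp: doubleton_eq_iff)
      moreover have "{x, y} \<noteq> {compl x, z0}"
      proof
        assume "{x, y} = {compl x, z0}"
        then have "compl x = x \<or> compl x = y" by blast
        then show False using var_y by (metis compl_neq(1) var_compl)
      qed
      ultimately have in_F: "{compl x, z} \<in> F - {{compl x, z0}}" "{x, y} \<in> F - {{compl x, z0}}"
        using z xy_clause by (auto simp: Z_clause)
      show ?thesis
        unfolding z(2) by (rule resolvent_true[OF bspec[OF \<phi> in_F(1)] bspec[OF \<phi> in_F(2)]])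
    qed
    then show ?thesis unfolding satisfiable_def by blast
  qed
qed

lemma vars_resolved: "vars resolved = vars F - {var x}"
proof
  show "vars resolved \<subseteq> vars F - {var x}"
  proof
    fix v assume "v \<in> vars resolved"
    then obtain C w where C: "C \<in> resolved" "w \<in> C" "v = var w" by (auto simp: vars_def)
    show "v \<in> vars F - {var x}"
    proof (cases "C \<in> untouched")
      case True
      then show ?thesis using C untouched_var[OF True C(2)] by (auto simp: vars_def untouched_def)
    next
      case False
      then obtain z where z: "z \<in> Z" "C = {z, y}" using C by (auto simp: resolved_def)
      have "var z \<in> vars F" "var y \<in> vars F"
        using z(1) imp_in_vars[of x z] imp_in_vars[OF xy_imp] by (auto simp: Z_def)
      then show ?thesis using C z var_Z[OF z(1)] var_y by auto
    qed
  qed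
  \<comment> \<open>Some resolvent exists, which keeps the variable of \<open>y\<close>
    alive.\<close>
  obtain z where "z \<in> Z" using Z_nonempty by blast
  then have "{z, y} \<in> resolved" by (auto simp: resolved_def)
  then have y: "var y \<in> vars resolved" unfolding vars_def by blast
  show "vars F - {var x} \<subseteq> vars resolved"
  proof
    fix v assume v: "v \<in> vars F - {var x}"
    then obtain C w where C: "C \<in> F" "w \<in> C" "v = var w" by (auto simp: vars_def)
    from C(1) show "v \<in> vars resolved"
    proof (cases rule: clause_cases)
      case 1
      then show ?thesis using C v y by auto
    next
      case (2 z)
      then have "w = z" using C v by auto
      moreover have "{z, y} \<in> resolved" using 2 by (auto simp: resolved_def)
      ultimately show ?thesis using C(3) unfolding vars_def by blast
    next
      case 3
      then have "C \<in> resolved" by (simp add: resolved_def)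
      then show ?thesis using C unfolding vars_def by blast
    qed
  qed
qed

lemma card_vars_resolved: "card (vars F) = Suc (card (vars resolved))"
  unfolding vars_resolved using imp_in_vars[OF xy_imp]
  by (intro card.remove finite_vars cnf) simp

text \<open>Clauses \<open>{compl x, z}\<close> and resolvents \<open>{z, y}\<close> both correspond
  injectively to \<open>Z\<close>, and the resolvents are new. So only \<open>{x, y}\<close> is lost
  in the count.\<close>

lemma card_resolved: "card F = Suc (card resolved)"
proof -
  have fin: "finite F" using cnf by (simp add: is_2cnf_def)
  then have finU: "finite untouched" by (simp add: untouched_def)
  let ?P = "(\<lambda>z. {compl x, z}) ` Z"
  have F: "F = insert {x, y} (untouched \<union> ?P)"
  proof (rule equalityI; rule subsetI)
    fix C assume "C \<in> F"
    then show "C \<in> insert {x, y} (untouched \<union> ?P)" by (cases rule: clause_cases) auto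
  next
    fix C assume "C \<in> insert {x, y} (untouched \<union> ?P)"
    then show "C \<in> F" using xy_clause Z_clause by (auto simp: untouched_def)
  qed
  have notP: "{x, y} \<notin> ?P"
  proof
    assume "{x, y} \<in> ?P"
    then have "compl x = x \<or> compl x = y" by blast
    then show False using var_y by (metis compl_neq(1) var_compl)
  qed
  have "{x, y} \<notin> untouched" "untouched \<inter> ?P = {}" by (auto simp: untouched_def)
  then have "card F = Suc (card untouched + card ?P)"
    using notP finU finite_Z by (subst F) (simp add: card_Un_disjoint)
  also have "card ?P = card Z" by (intro card_image inj_onI) (auto simp: doubleton_eq_iff)
  also have "\<dots> = card ((\<lambda>z. {z, y}) ` Z)"
    by (intro card_image[symmetric] inj_onI) (auto simp: doubleton_eq_iff)
  also have "card untouched + \<dots> = card resolved"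
    unfolding resolved_def using finU finite_Z resolvent_notin
    by (intro card_Un_disjoint[symmetric]) (auto simp: untouched_def)
  finally show ?thesis .
qed

lemma resolved_mu: "mu_2cnf resolved"
proof
  have "finite resolved"
    using cnf finite_Z by (simp add: resolved_def untouched_def is_2cnf_def)
  moreover have "is_clause C \<and> card C \<le> 2" if C: "C \<in> resolved" for C
  proof (cases "C \<in> untouched")
    case True
    then show ?thesis using cnf by (auto simp: is_2cnf_def untouched_def)
  next
    case False
    then obtain z where z: "z \<in> Z" "C = {z, y}" using C by (auto simp: resolved_def)
    \<comment> \<open>This keeps the resolvent from being tautological.\<close>
    then have "z \<noteq> compl y" using compl_y_notin_Z by auto
    then have "compl z \<noteq> y" by auto
    then show ?thesis using \<open>z \<noteq> compl y\<close> card_doubleton_le[of z y]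
      by (auto simp: is_clause_def z(2))
  qed
  ultimately show "is_2cnf resolved" by (simp add: is_2cnf_def)
  show "{} \<notin> resolved" using nonempty by (auto simp: resolved_def untouched_def)
  show "minimally_unsatisfiable resolved"
    using resolved_unsat resolved_minimal by (simp add: minimally_unsatisfiable_def)
qed

end

text \<open>In the application \<open>c\<close> is complementation of literals and \<open>x'\<close>, \<open>y'\<close> are the complements
  of \<open>x\<close>, \<open>y\<close>.\<close>

lemma split_vertex_pair:
  assumes G: "parcs G = B \<union> (\<lambda>z. (c z, y)) ` Z \<union> Pair y' ` Z"
    and B: "y \<notin> Range B" "y' \<notin> Domain B"
    and Z: "y \<notin> Z" "y' \<notin> Z" "y \<notin> c ` Z" "y' \<notin> c ` Z"
    and neq: "y \<noteq> y'" "x' \<noteq> y'"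
  shows "parcs (split_vertex (split_vertex G y x' y) y' y' x) =
    B \<union> {(x', y), (y', x)} \<union> Pair x ` Z \<union> (\<lambda>z. (c z, x')) ` Z"
proof -
  have G1: "parcs (split_vertex G y x' y) =
      B \<union> {(x', y)} \<union> Pair y' ` Z \<union> (\<lambda>z. (c z, x')) ` Z" (is "_ = ?G1")
    unfolding split_vertex_def pair_pre_digraph.simps G using B(1) Z neq by (auto simp: image_iff)
  show ?thesis
    unfolding split_vertex_def[of "split_vertex G y x' y"] pair_pre_digraph.simps G1
    using B(2) Z neq by (auto simp: image_iff)
qed

section \<open>Undoing the elimination by splittings\<close>

context mu_2cnf_singular
begin

definition core :: "'a lit rel" where
  "core = {(a, b) \<in> imp F. var a \<noteq> var x \<and> var b \<noteq> var x}"

lemma imp_untouched: "imp untouched = core"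
proof -
  have "{compl a, b} \<in> untouched \<longleftrightarrow> {compl a, b} \<in> F \<and> var a \<noteq> var x \<and> var b \<noteq> var x" for a b
    unfolding untouched_def var_eq_iff[of a x] var_eq_iff[of b x]
    by (metis (no_types, lifting) compl_compl insert_iff mem_Collect_eq singletonD)
  then show ?thesis unfolding imp_def core_def by auto
qed

lemma doubleton_compl_eq:
  "{compl a, b} = {w, y} \<longleftrightarrow> (a, b) = (compl w, y) \<or> (a, b) = (compl y, w)"
  unfolding doubleton_eq_iff prod.inject by (metis compl_compl)

lemma imp_resolved: "imp resolved = core \<union> (\<lambda>z. (compl z, y)) ` Z \<union> Pair (compl y) ` Z"
proof -
  have "imp resolved = imp untouched \<union> {(a, b). \<exists>z\<in>Z. {compl a, b} = {z, y}}"
    by (auto simp: imp_def resolved_def)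
  also have "{(a, b). \<exists>z\<in>Z. {compl a, b} = {z, y}} =
      (\<lambda>z. (compl z, y)) ` Z \<union> Pair (compl y) ` Z"
    unfolding doubleton_compl_eq by blast
  finally show ?thesis unfolding imp_untouched by blast
qed

text \<open>Compared with \<open>imp_resolved\<close>, each arc from \<open>compl z\<close> to
  \<open>y\<close> now passes through \<open>compl x\<close>, and each arc from
  \<open>compl y\<close> to \<open>z\<close> through \<open>x\<close>. This is what the splittings
  have to achieve.\<close>

lemma imp_eq:
  "imp F = core \<union> {(compl x, y), (compl y, x)} \<union> Pair x ` Z \<union> (\<lambda>z. (compl z, compl x)) ` Z"
    (is "_ = ?R")
proof
  have "(a, b) \<in> ?R" if ab: "(a, b) \<in> imp F" for a b
  proof -
    consider "a = x" | "a = compl x" | "b = x" | "b = compl x" | "var a \<noteq> var x" "var b \<noteq> var x"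
      using var_eq_iff[of a x] var_eq_iff[of b x] by blast
    then show ?thesis
    proof cases
      case 1 then show ?thesis using ab by (simp add: Z_def)
    next
      case 2
      then have "b = y" using ab singular by blast
      with 2 show ?thesis by simp
    next
      case 3
      then have "compl a = y" using imp_contrapos[OF ab] singular by blast
      then have "a = compl y" by (metis compl_compl)
      with 3 show ?thesis by simp
    next
      case 4
      then have "compl a \<in> Z" using imp_contrapos[OF ab] by (simp add: Z_def)
      then have "(compl (compl a), compl x) \<in> (\<lambda>z. (compl z, compl x)) ` Z" by (rule imageI)
      with 4 show ?thesis by simp
    next
      case 5 then show ?thesis using ab by (simp add: core_def)
    qed
  qed
  then show "imp F \<subseteq> ?R" by auto
  have "Pair x ` Z \<subseteq> imp F" by (auto simp: Z_def)
  moreover have "(\<lambda>z. (compl z, compl x)) ` Z \<subseteq> imp F"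
    using imp_contrapos[of x] by (auto simp: Z_def)
  moreover have "core \<subseteq> imp F" by (auto simp: core_def)
  moreover have "(compl y, x) \<in> imp F" using imp_contrapos[OF xy_imp] by simp
  ultimately show "?R \<subseteq> imp F" using xy_imp by blast
qed

lemma literals_eq:
  "{w. var w \<in> vars F} = {w. var w \<in> vars resolved} \<union> {x, compl x}"
proof -
  have "var x \<in> vars F" using imp_in_vars[OF xy_imp] by simp
  then show ?thesis unfolding vars_resolved by (auto simp: var_eq_iff)
qed

text \<open>If \<open>Z = {z}\<close>, both arcs of the single resolvent are subdivided. If
  \<open>Z\<close> has two elements, the resolvents account for all arcs out of
  \<open>compl y\<close> and into \<open>y\<close>, so splitting these vertices reroutes exactly
  those arcs.\<close>

lemma weak_double_cycle_lift:
  assumes wdc: "weak_double_cycle m (idg resolved)"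
  shows "weak_double_cycle m (idg F)"
proof -
  interpret R: mu_2cnf resolved by (rule resolved_mu)
  \<comment> \<open>Elimination preserves the deficiency, which is too large for a unit
    clause.\<close>
  have no_unit': "{u} \<notin> resolved" for u
    using R.unit_clause_deficiency[of u] deficiency_ge_2 card_vars_resolved card_resolved by auto
  have "y \<notin> Z"
  proof
    assume "y \<in> Z"
    then have "{y, y} \<in> resolved" unfolding resolved_def by blast
    with no_unit'[of y] show False by simp
  qed
  have fin: "finite (pverts (idg resolved))"
    unfolding pverts_idg by (intro card_literals finite_vars R.cnf)
  have y: "var y \<in> vars resolved" using var_y imp_in_vars[OF xy_imp] by (simp add: vars_resolved)
  have x: "var x \<notin> vars resolved" by (simp add: vars_resolved)
  have core_res: "(compl z, y) \<notin> core" "(compl y, z) \<notin> core" if "z \<in> Z" for z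
    using resolvent_notin[OF that] by (auto simp: core_def imp_def insert_commute)
  have "card Z \<le> 2" unfolding Z_def by (rule out_degree_le_2)
  moreover have "card Z \<noteq> 0" using Z_nonempty finite_Z by simp
  ultimately have "card Z = 1 \<or> card Z = 2" by linarith
  then show ?thesis
  proof
    assume "card Z = 1"
    then obtain z where Z: "Z = {z}" by (auto simp: card_1_singleton_iff)
    then have z: "z \<in> Z" by simp
    have zy: "z \<noteq> y" using \<open>y \<notin> Z\<close> z by blast
    let ?G1 = "split_arc (idg resolved) (compl z) y (compl x)"
    let ?G2 = "split_arc ?G1 (compl y) z x"
    have R: "parcs (idg resolved) = insert (compl z, y) (insert (compl y, z) core)"
      unfolding parcs_idg imp_resolved Z by auto
    have arcs1: "parcs ?G1 = insert (compl y, z) (core \<union> {(compl z, compl x), (compl x, y)})"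
      unfolding split_arc_def pair_pre_digraph.simps R using core_res[OF z] zy by auto
    have "(compl y, z) \<noteq> (compl z, compl x)" "(compl y, z) \<noteq> (compl x, y)"
      using zy by auto
    then have "parcs ?G2 = core \<union> {(compl z, compl x), (compl x, y), (compl y, x), (x, z)}"
      unfolding split_arc_def[of ?G1] pair_pre_digraph.simps arcs1 using core_res[OF z] by auto
    also have "\<dots> = imp F" unfolding imp_eq Z by auto
    finally have arcs2: "parcs ?G2 = imp F" .
    have verts1: "pverts ?G1 = insert (compl x) {w. var w \<in> vars resolved}"
      by (simp add: split_arc_def pverts_idg)
    have verts2: "pverts ?G2 = {w. var w \<in> vars F}"
      unfolding split_arc_def[of ?G1] pair_pre_digraph.simps verts1 literals_eq by auto
    have "weak_double_cycle m ?G1"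
      using x by (intro weak_double_cycle_split_arc wdc fin) (simp_all add: R pverts_idg)
    then have "weak_double_cycle m ?G2"
    proof (rule weak_double_cycle_split_arc)
      show "finite (pverts ?G1)" using fin by (simp add: verts1 pverts_idg)
      show "(compl y, z) \<in> parcs ?G1" by (simp add: arcs1)
      show "x \<notin> pverts ?G1" using x by (simp add: verts1)
    qed
    moreover have "?G2 = idg F"
      by (rule pair_pre_digraph.equality) (simp_all add: arcs2 verts2 parcs_idg pverts_idg)
    ultimately show ?thesis by simp
  next
    assume card_Z: "card Z = 2"
    have "Z \<subseteq> imp resolved `` {compl y}" unfolding imp_resolved by blast
    moreover have "card Z = card (imp resolved `` {compl y})"
      using card_Z R.out_degree_le_2[of "compl y"] card_mono[OF R.finite_out calculation] by simp
    \<comment> \<open>\<open>Z\<close> already fills the out-degree bound 2 at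
      \<open>compl y\<close>, so no arc of \<open>core\<close> leaves \<open>compl y\<close> and, by
      contraposition, none enters \<open>y\<close>.\<close>
    ultimately have out: "imp resolved `` {compl y} = Z"
      using card_subset_eq[OF R.finite_out] by blast
    have core_y': "compl y \<notin> Domain core"
    proof
      assume "compl y \<in> Domain core"
      then obtain b where b: "(compl y, b) \<in> core" by blast
      then have "b \<in> Z" using out imp_resolved by blast
      with b core_res(2) show False by blast
    qed
    have core_y: "y \<notin> Range core"
    proof
      assume "y \<in> Range core"
      then obtain a where "(a, y) \<in> core" by blast
      then have "(compl y, compl a) \<in> core"
        using imp_contrapos[of a y F] by (simp add: core_def)
      with core_y' show False by blast
    qed
    have cZ: "y \<notin> compl ` Z" "compl y \<notin> compl ` Z"
      using compl_y_notin_Z \<open>y \<notin> Z\<close> by (metis compl_compl imageE)+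
    \<comment> \<open>In the first splitting the name \<open>y\<close> stays with the out-side,
      behind \<open>compl x\<close>; in the second, \<open>compl y\<close> stays with the in-side,
      in front of \<open>x\<close>.\<close>
    let ?G1 = "split_vertex (idg resolved) y (compl x) y"
    let ?G2 = "split_vertex ?G1 (compl y) (compl y) x"
    have neq: "compl x \<noteq> compl y" using var_y by auto
    have arcs2: "parcs ?G2 = imp F"
      unfolding imp_eq
      by (rule split_vertex_pair[OF trans[OF parcs_idg imp_resolved] core_y core_y' \<open>y \<notin> Z\<close>
        compl_y_notin_Z cZ compl_neq(2) neq])
    have verts1: "pverts ?G1 = insert (compl x) {w. var w \<in> vars resolved}"
      using y by (auto simp: split_vertex_def pverts_idg)
    have verts2: "pverts ?G2 = {w. var w \<in> vars F}"
      unfolding split_vertex_def[of ?G1] pair_pre_digraph.simps verts1 literals_eq using y by auto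
    have loop: "(w, w) \<notin> imp resolved" for w using imp_not_refl[OF R.cnf] by blast
    have "weak_double_cycle m ?G1"
    proof (rule weak_double_cycle_split_vertex[OF wdc fin])
      show "y \<in> pverts (idg resolved)" using y by (simp add: pverts_idg)
      show "(y, y) \<notin> parcs (idg resolved)" using loop by (simp add: parcs_idg)
      show "compl x \<notin> pverts (idg resolved) - {y}" using x by (simp add: pverts_idg)
      show "compl x \<noteq> y" using var_y by auto
    qed simp
    then have "weak_double_cycle m ?G2"
    proof (rule weak_double_cycle_split_vertex)
      show "finite (pverts ?G1)" unfolding verts1 using fin by (simp add: pverts_idg)
      show "compl y \<in> pverts ?G1" unfolding verts1 using y by simp
      show "(compl y, compl y) \<notin> parcs ?G1"
        unfolding split_vertex_def pair_pre_digraph.simps parcs_idg using loop neq by auto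
      show "x \<notin> pverts ?G1 - {compl y}" unfolding verts1 using x by simp
      show "compl y \<noteq> x" using var_y by auto
    qed simp
    moreover have "?G2 = idg F"
      by (rule pair_pre_digraph.equality) (simp_all add: arcs2 verts2 parcs_idg pverts_idg)
    ultimately show ?thesis by simp
  qed
qed

end

text \<open>Elimination of a singular literal removes one clause and one variable, so
  \<open>k\<close> is unchanged while the induction on the number of variables descends to a
  nonsingular clause-set.\<close>

lemma (in mu_2cnf) weak_double_cycle_idg:
  assumes "2 \<le> k" "card F = card (vars F) + k"
  shows "weak_double_cycle (2 * k) (idg F)"
  using mu_2cnf_axioms assms(2)
proof (induction "card (vars F)" arbitrary: F rule: less_induct)
  case less
  interpret mu_2cnf F by (rule less.prems)
  have def2: "card (vars F) + 2 \<le> card F" using less.prems(2) assms(1) by simp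
  show ?case
  proof (cases "\<forall>x. var x \<in> vars F \<longrightarrow> card (imp F `` {x}) = 2")
    case True
    interpret mu_2cnf_nonsingular F by unfold_locales (use def2 True in auto)
    \<comment> \<open>Twice the number of variables equals that number plus \<open>k\<close>, so the
      double cycle has length \<open>2 * k\<close>.\<close>
    have "card (vars F) = k" using card_eq less.prems(2) by simp
    with weak_double_cycle_idg show ?thesis by simp
  next
    case False
    then obtain x where x: "var x \<in> vars F" "card (imp F `` {x}) \<noteq> 2" by blast
    then have "card (imp F `` {x}) \<noteq> 0"
      using out_neighbour_exists[OF x(1)] finite_out[of x] by auto
    then have "card (imp F `` {x}) = 1" using out_degree_le_2[of x] x(2) by linarith
    then obtain y where y: "imp F `` {x} = {y}" by (auto simp: card_1_singleton_iff)
    \<comment> \<open>The locale speaks of the out-neighbours of the complement of its parameter,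
      hence the parameter \<open>compl x\<close>.\<close>
    interpret mu_2cnf_singular F "compl x" y by unfold_locales (use def2 y in simp_all)
    show ?thesis
      using less.hyps[of resolved] resolved_mu card_vars_resolved card_resolved less.prems(2)
      by (intro weak_double_cycle_lift) simp
  qed
qed

theorem theorem7p4:
  fixes F :: "'v clause set" and k :: nat
  assumes "2 \<le> k"
    and "is_2cnf F"
    and "minimally_unsatisfiable F"
    and "deficiency F = int k"
  shows "weak_double_cycle (2 * k) (idg F)"
proof -
  have "{} \<notin> F"
  proof
    assume "{} \<in> F"
    \<comment> \<open>The empty clause is unsatisfiable by itself, so minimality admits no other
      clause, and the deficiency would be 1.\<close>
    have "F = {{}}"
    proof (rule ccontr)
      assume "F \<noteq> {{}}"
      with \<open>{} \<in> F\<close> obtain C where "C \<in> F" "C \<noteq> {}" by blast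
      with assms(3) have "satisfiable (F - {C})" by (simp add: minimally_unsatisfiable_def)
      moreover have "{} \<in> F - {C}" using \<open>{} \<in> F\<close> \<open>C \<noteq> {}\<close> by simp
      ultimately show False unfolding satisfiable_def by blast
    qed
    then have "deficiency F = 1" by (simp add: deficiency_def vars_def)
    with assms(1,4) show False by simp
  qed
  then interpret mu_2cnf F using assms(2,3) by unfold_locales
  show ?thesis
    using assms(1,4) by (intro weak_double_cycle_idg) (simp_all add: deficiency_def)
qed

end
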